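(* Let $(\mathcal{M},\circ)$ be a compact, connected, simply connected analytic Moufang loop with identity $e$. Then its tangent Malcev algebra $\mathfrak{M}=T_e\mathcal{M}$ is almost periodic, i.e. for all $x,y\in\mathfrak{M}$ the orbit $\{e^{t\,\operatorname{ad}(x)}(y):t\in\mathbb{R}\}$ is relatively compact in $\mathfrak{M}$.
   Context: An analytic Moufang loop is a (finite-dimensional) real-analytic manifold $\mathcal{M}$ with an analytic loop multiplication $\circ$ (with identity $e$ and analytic left and right divisions) satisfying the Moufang identities. Its tangent space $\mathfrak{M}=T_e\mathcal{M}$ carries a natural Malcev algebra structure given by the commutator of left-invariant vector fields, i.e. a bilinear anti-commutative bracket with $J(x,y,[x,z])=[J(x,y,z),x]$, where $J(x,y,z)=[[x,y],z]+[[y,z],x]+[[z,x],y]$. Here $\operatorname{ad}(x)\colon y\mapsto[x,y]$ and $e^{t\,\operatorname{ad}(x)}=\sum_{n\ge0}\frac{t^n}{n!}\operatorname{ad}(x)^n$; $\mathfrak{M}$ is finite-dimensional and is given any norm. *)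

theory Defs
  imports "HOL-Analysis.Analysis"
begin

section \<open>Real-analytic maps and manifolds\<close>

text \<open>Finite-dimensional model spaces are taken from \<open>real_normed_vector\<close> rather than
  \<open>euclidean_space\<close>, so that the norm is arbitrary and dimension 0 is included.\<close>

definition finite_dim :: "'e::real_vector itself \<Rightarrow> bool" where
  "finite_dim _ \<longleftrightarrow> (\<exists>B::'e set. finite B \<and> span B = UNIV)"

text \<open>Near \<open>x\<close>, the map \<open>f\<close> is the sum of a power series in the coordinates \<open>u\<close> with respect to
  some basis \<open>B\<close>. The multi-indices are the extensional functions \<open>B \<rightarrow>\<^sub>E UNIV\<close> into the naturals;
  \<open>has_sum\<close> is unconditional convergence.\<close>

definition real_analytic_at ::
    "('e::real_normed_vector \<Rightarrow> 'f::real_normed_vector) \<Rightarrow> 'e \<Rightarrow> bool" where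
  "real_analytic_at f x \<longleftrightarrow>
     (\<exists>(B::'e set) (r::real) (c :: ('e \<Rightarrow> nat) \<Rightarrow> 'f).
        finite B \<and> independent B \<and> span B = UNIV \<and> r > 0 \<and>
        (\<forall>u::'e \<Rightarrow> real. (\<forall>b\<in>B. \<bar>u b\<bar> < r) \<longrightarrow>
           ((\<lambda>\<alpha>. (\<Prod>b\<in>B. u b ^ \<alpha> b) *\<^sub>R c \<alpha>) has_sum f (x + (\<Sum>b\<in>B. u b *\<^sub>R b)))
             (B \<rightarrow>\<^sub>E UNIV)))"

text \<open>A chart is a pair of its domain and its coordinate map. Values of the coordinate map outside
  the domain are irrelevant.\<close>

type_synonym ('m, 'e) chart = "'m set \<times> ('m \<Rightarrow> 'e)"

fun chart_inv :: "('m, 'e) chart \<Rightarrow> 'e \<Rightarrow> 'm" where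
  "chart_inv (U, \<phi>) = inv_into U \<phi>"

definition is_chart :: "('m::topological_space, 'e::real_normed_vector) chart \<Rightarrow> bool" where
  "is_chart \<kappa> \<longleftrightarrow> open (fst \<kappa>) \<and> open (snd \<kappa> ` fst \<kappa>) \<and>
     homeomorphism (fst \<kappa>) (snd \<kappa> ` fst \<kappa>) (snd \<kappa>) (chart_inv \<kappa>)"

definition analytic_atlas ::
    "('m::{t2_space, second_countable_topology}, 'e::real_normed_vector) chart set \<Rightarrow> bool" where
  "analytic_atlas A \<longleftrightarrow>
     finite_dim TYPE('e) \<and>
     (\<forall>\<kappa>\<in>A. is_chart \<kappa>) \<and>
     (\<Union>\<kappa>\<in>A. fst \<kappa>) = UNIV \<and>
     (\<forall>\<kappa>\<in>A. \<forall>\<mu>\<in>A. \<forall>p \<in> fst \<kappa> \<inter> fst \<mu>.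
        real_analytic_at (\<lambda>z. snd \<mu> (chart_inv \<kappa> z)) (snd \<kappa> p))"

definition product_atlas ::
    "('m, 'e) chart set \<Rightarrow> ('n, 'f) chart set \<Rightarrow> ('m \<times> 'n, 'e \<times> 'f) chart set" where
  "product_atlas A B =
     {(fst \<kappa> \<times> fst \<mu>, map_prod (snd \<kappa>) (snd \<mu>)) | \<kappa> \<mu>. \<kappa> \<in> A \<and> \<mu> \<in> B}"

definition analytic_map ::
    "('m::topological_space, 'e::real_normed_vector) chart set \<Rightarrow>
     ('n::topological_space, 'f::real_normed_vector) chart set \<Rightarrow> ('m \<Rightarrow> 'n) \<Rightarrow> bool" where
  "analytic_map A B f \<longleftrightarrow>
     continuous_on UNIV f \<and>
     (\<forall>\<kappa>\<in>A. \<forall>\<mu>\<in>B. \<forall>p \<in> fst \<kappa>. f p \<in> fst \<mu> \<longrightarrow>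
        real_analytic_at (\<lambda>z. snd \<mu> (f (chart_inv \<kappa> z))) (snd \<kappa> p))"


section \<open>Analytic Moufang loops\<close>

definition is_loop :: "('m \<Rightarrow> 'm \<Rightarrow> 'm) \<Rightarrow> 'm \<Rightarrow> bool" where
  "is_loop m e \<longleftrightarrow>
     (\<forall>a. m e a = a \<and> m a e = a) \<and>
     (\<forall>a b. \<exists>!x. m a x = b) \<and>
     (\<forall>a b. \<exists>!y. m y a = b)"

definition left_div :: "('m \<Rightarrow> 'm \<Rightarrow> 'm) \<Rightarrow> 'm \<Rightarrow> 'm \<Rightarrow> 'm" where
  "left_div m a b = (THE x. m a x = b)"

definition right_div :: "('m \<Rightarrow> 'm \<Rightarrow> 'm) \<Rightarrow> 'm \<Rightarrow> 'm \<Rightarrow> 'm" where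
  "right_div m b a = (THE y. m y a = b)"

text \<open>In a loop the three Moufang identities (left, right, middle) are equivalent.\<close>

definition moufang_loop :: "('m \<Rightarrow> 'm \<Rightarrow> 'm) \<Rightarrow> 'm \<Rightarrow> bool" where
  "moufang_loop m e \<longleftrightarrow>
     is_loop m e \<and>
     (\<forall>a b c. m a (m b (m a c)) = m (m (m a b) a) c) \<and>
     (\<forall>a b c. m (m (m c a) b) a = m c (m a (m b a))) \<and>
     (\<forall>a b c. m (m a b) (m c a) = m (m a (m b c)) a)"

definition analytic_moufang_loop ::
    "('m::{t2_space, second_countable_topology}, 'e::real_normed_vector) chart set \<Rightarrow>
     ('m \<Rightarrow> 'm \<Rightarrow> 'm) \<Rightarrow> 'm \<Rightarrow> bool" where
  "analytic_moufang_loop A m e \<longleftrightarrow>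
     analytic_atlas A \<and>
     moufang_loop m e \<and>
     analytic_map (product_atlas A A) A (\<lambda>(a, b). m a b) \<and>
     analytic_map (product_atlas A A) A (\<lambda>(a, b). left_div m a b) \<and>
     analytic_map (product_atlas A A) A (\<lambda>(b, a). right_div m b a)"


section \<open>The tangent algebra\<close>

text \<open>A chart \<open>\<kappa>\<close> at \<open>e\<close> identifies the tangent space at \<open>e\<close> linearly with the model space. In the
  coordinates of \<open>\<kappa>\<close>, the left-invariant vector field with value \<open>v\<close> at \<open>e\<close> takes at the point
  with coordinates \<open>z\<close> the value \<open>d(L\<^sub>a)\<^sub>e v\<close>, where \<open>a = chart_inv \<kappa> z\<close> and \<open>L\<^sub>a b = m a b\<close>.\<close>

definition left_inv_field ::
    "('m \<Rightarrow> 'm \<Rightarrow> 'm) \<Rightarrow> 'm \<Rightarrow> ('m, 'e::real_normed_vector) chart \<Rightarrow> 'e \<Rightarrow> 'e \<Rightarrow> 'e" where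
  "left_inv_field m e \<kappa> v z =
     frechet_derivative (\<lambda>y. snd \<kappa> (m (chart_inv \<kappa> z) (chart_inv \<kappa> y))) (at (snd \<kappa> e)) v"

text \<open>The commutator \<open>XY - YX\<close> of vector fields, acting as derivations, in coordinates.\<close>

definition lie_bracket ::
    "('e::real_normed_vector \<Rightarrow> 'e) \<Rightarrow> ('e \<Rightarrow> 'e) \<Rightarrow> 'e \<Rightarrow> 'e" where
  "lie_bracket X Y z =
     frechet_derivative Y (at z) (X z) - frechet_derivative X (at z) (Y z)"

text \<open>The commutator of two left-invariant fields need not be left-invariant for a nonassociative
  loop; the bracket of the tangent algebra is its value at \<open>e\<close>.\<close>

definition tangent_bracket ::
    "('m \<Rightarrow> 'm \<Rightarrow> 'm) \<Rightarrow> 'm \<Rightarrow> ('m, 'e::real_normed_vector) chart \<Rightarrow> 'e \<Rightarrow> 'e \<Rightarrow> 'e" where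
  "tangent_bracket m e \<kappa> v w =
     lie_bracket (left_inv_field m e \<kappa> v) (left_inv_field m e \<kappa> w) (snd \<kappa> e)"

definition exp_ad :: "('e::real_normed_vector \<Rightarrow> 'e \<Rightarrow> 'e) \<Rightarrow> real \<Rightarrow> 'e \<Rightarrow> 'e \<Rightarrow> 'e" where
  "exp_ad br t x y = (\<Sum>n. (t ^ n / fact n) *\<^sub>R (br x ^^ n) y)"

definition almost_periodic :: "('e::real_normed_vector \<Rightarrow> 'e \<Rightarrow> 'e) \<Rightarrow> bool" where
  "almost_periodic br \<longleftrightarrow> (\<forall>x y. compact (closure (range (\<lambda>t. exp_ad br t x y))))"

end

theory Submission
  imports Defs
begin

text \<open>The idea is that the orbit of \<open>y\<close> under \<open>e\<^bsup>t ad x\<^esup>\<close> lies in a compact set that is visible on the loop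
  itself. For \<open>a\<close> in the loop, the inner map \<open>b \<mapsto> (a b) / a\<close> fixes \<open>e\<close>; let \<open>Ad a\<close> be its derivative
  there. The vector \<open>Ad a y\<close> depends continuously on \<open>a\<close> (\<open>continuous_Ad\<close>), so its values form a compact
  set \<open>K\<close> when the loop is compact.

  Two facts connect \<open>K\<close> with the exponential. The derivative of \<open>Ad\<close> at \<open>e\<close> in the direction \<open>x\<close> is
  \<open>ad x\<close> (\<open>Ad_has_derivative_bracket\<close>): this follows by differentiating the relation \<open>((a b) / a) a = a b\<close>
  twice and using the symmetry of second derivatives. The Moufang identities give
  \<open>Ad (a\<^sup>n) = (Ad a)\<^sup>n\<close> (\<open>Ad_loop_power\<close>): left multiplication by \<open>a\<^sup>n\<close> is the \<open>n\<close>-th power of left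
  multiplication by \<open>a\<close>, likewise on the right, and left and right multiplication by \<open>a\<close> commute.

  Now let \<open>a\<^sub>n\<close> be the point with coordinates \<open>p + (t/n) x\<close>, where \<open>p\<close> are the coordinates of \<open>e\<close>. Then
  \<open>Ad a\<^sub>n = id + (t/n) ad x + o(1/n)\<close>, so that \<open>(Ad a\<^sub>n)\<^sup>n y\<close> tends to \<open>e\<^bsup>t ad x\<^esup> y\<close>
  (\<open>exp_series_limit_perturbed\<close>). Since \<open>(Ad a\<^sub>n)\<^sup>n y = Ad (a\<^sub>n\<^sup>n) y\<close> is in \<open>K\<close>, so is the limit.

  The analytic input is that a real-analytic map between finite-dimensional spaces has a derivative nearby
  that is differentiable at the point, with a symmetric second derivative
  (\<open>real_analytic_twice_differentiable\<close>). It comes from termwise differentiation of power series.\<close>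

section \<open>Finite-dimensional normed spaces\<close>

text \<open>Enlarge an independent set by one vector \<open>a\<close>: bounded coordinates make the old span closed, so
  \<open>a\<close> has positive distance from it, and this distance bounds the new coordinate.\<close>

lemma bounded_coordinates:
  fixes B :: "'a::real_normed_vector set"
  assumes "finite B" "independent B"
  shows "\<exists>K>0. \<forall>u. \<forall>b\<in>B. \<bar>u b\<bar> \<le> K * norm (\<Sum>b\<in>B. u b *\<^sub>R b)"
  using assms
proof (induction B)
  case empty
  show ?case by (auto intro: exI[of _ 1])
next
  case (insert a B)
  have ind: "independent B" and a: "a \<notin> span B"
    using insert.prems insert.hyps by (auto simp: independent_insert)
  then obtain K where K: "K > 0" "\<And>u b. b \<in> B \<Longrightarrow> \<bar>u b\<bar> \<le> K * norm (\<Sum>b\<in>B. u b *\<^sub>R b)"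
    using insert.IH by blast
  have "closed (span B)"
    unfolding closed_sequential_limits
  proof (intro allI impI, elim conjE)
    fix s l assume s: "\<forall>n. s n \<in> span B" and l: "s \<longlonglongrightarrow> l"
    define u where "u n = representation B (s n)" for n
    have su: "(\<Sum>b\<in>B. u n b *\<^sub>R b) = s n" for n
      unfolding u_def using s insert.hyps ind by (intro real_vector.sum_representation_eq) auto
    have "\<exists>x. (\<lambda>n. u n b) \<longlonglongrightarrow> x" if "b \<in> B" for b
    proof -
      have "Cauchy (\<lambda>n. u n b)"
      proof (rule metric_CauchyI)
        fix e :: real assume "e > 0"
        have "Cauchy s" using l by (auto intro: convergent_Cauchy convergentI)
        moreover have "e / K > 0" using \<open>e > 0\<close> K(1) by simp
        ultimately obtain M where M: "\<And>m n. m \<ge> M \<Longrightarrow> n \<ge> M \<Longrightarrow> dist (s m) (s n) < e / K"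
          by (meson metric_CauchyD)
        have "dist (u m b) (u n b) < e" if "m \<ge> M" "n \<ge> M" for m n
        proof -
          have "\<bar>u m b - u n b\<bar> \<le> K * norm (\<Sum>b\<in>B. (u m b - u n b) *\<^sub>R b)"
            using K(2)[OF \<open>b \<in> B\<close>, of "\<lambda>b. u m b - u n b"] .
          also have "(\<Sum>b\<in>B. (u m b - u n b) *\<^sub>R b) = s m - s n"
            by (simp add: scaleR_diff_left sum_subtractf su)
          also have "K * norm (s m - s n) < e"
            using M[OF that] K(1) by (simp add: dist_norm field_simps)
          finally show ?thesis by (simp add: dist_real_def)
        qed
        then show "\<exists>M. \<forall>m\<ge>M. \<forall>n\<ge>M. dist (u m b) (u n b) < e" by blast
      qed
      then show ?thesis by (simp add: Cauchy_convergent_iff convergent_def)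
    qed
    then obtain x where "\<And>b. b \<in> B \<Longrightarrow> (\<lambda>n. u n b) \<longlonglongrightarrow> x b" by metis
    then have "(\<lambda>n. \<Sum>b\<in>B. u n b *\<^sub>R b) \<longlonglongrightarrow> (\<Sum>b\<in>B. x b *\<^sub>R b)"
      by (intro tendsto_sum tendsto_scaleR) auto
    then have "l = (\<Sum>b\<in>B. x b *\<^sub>R b)" using l unfolding su by (rule LIMSEQ_unique[rotated])
    then show "l \<in> span B" by (simp add: span_sum span_scale span_base)
  qed
  then obtain d where d: "d > 0" "ball a d \<subseteq> - span B"
    using a by (meson ComplI open_Compl open_contains_ball)
  have ta: "\<bar>t\<bar> * d \<le> norm (t *\<^sub>R a + s)" if "s \<in> span B" for t s
  proof (cases "t = 0")
    case False
    have "- (s /\<^sub>R t) \<in> span B" using that by (intro span_neg span_scale)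
    then have "d \<le> norm (a + s /\<^sub>R t)"
      using d(2) by (force simp: subset_iff dist_norm not_less)
    then have "\<bar>t\<bar> * d \<le> \<bar>t\<bar> * norm (a + s /\<^sub>R t)" by (simp add: mult_left_mono)
    also have "\<dots> = norm (t *\<^sub>R (a + s /\<^sub>R t))" by simp
    also have "t *\<^sub>R (a + s /\<^sub>R t) = t *\<^sub>R a + s" using False by (simp add: scaleR_add_right)
    finally show ?thesis .
  qed auto
  define K' where "K' = 1 / d + K * (1 + norm a / d)"
  have K': "K' > 0" unfolding K'_def using K(1) d(1) by (simp add: add_pos_nonneg)
  moreover have "\<bar>u b\<bar> \<le> K' * norm (\<Sum>b\<in>insert a B. u b *\<^sub>R b)" if b: "b \<in> insert a B" for u b
  proof -
    define s v where "s = (\<Sum>b\<in>B. u b *\<^sub>R b)" and "v = u a *\<^sub>R a + s"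
    have v: "(\<Sum>b\<in>insert a B. u b *\<^sub>R b) = v" using insert.hyps by (simp add: v_def s_def)
    have "s \<in> span B" unfolding s_def by (simp add: span_sum span_scale span_base)
    from ta[OF this, of "u a"] have ua: "\<bar>u a\<bar> \<le> norm v / d"
      using d(1) by (simp add: v_def field_simps)
    have "norm s \<le> norm v + \<bar>u a\<bar> * norm a"
      using norm_triangle_ineq4[of v "u a *\<^sub>R a"] by (simp add: v_def)
    also have "\<dots> \<le> norm v + (norm v / d) * norm a" using ua by (intro add_left_mono mult_right_mono) auto
    finally have ns: "norm s \<le> norm v * (1 + norm a / d)" by (simp add: algebra_simps)
    have "\<bar>u b\<bar> \<le> norm v / d + K * (norm v * (1 + norm a / d))"
    proof (cases "b = a")
      case True
      have "0 \<le> K * (norm v * (1 + norm a / d))" using K(1) d(1) by simp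
      then show ?thesis using ua True by simp
    next
      case False
      then have "\<bar>u b\<bar> \<le> K * norm s" using b K(2)[of b u] by (auto simp: s_def)
      also have "\<dots> \<le> K * (norm v * (1 + norm a / d))" using ns K(1) by simp
      also have "\<dots> \<le> norm v / d + \<dots>" using d(1) by simp
      finally show ?thesis .
    qed
    also have "\<dots> = K' * norm v" by (simp add: K'_def algebra_simps)
    finally show ?thesis unfolding v .
  qed
  ultimately show ?case by blast
qed

locale finite_basis =
  fixes B :: "'a::real_normed_vector set"
  assumes finite_B [simp, intro]: "finite B"
    and independent_B: "independent B"
    and span_B: "span B = UNIV"
begin

definition coord :: "'a \<Rightarrow> 'a \<Rightarrow> real" where
  "coord b v = representation B v b"

lemma sum_coord: "(\<Sum>b\<in>B. coord b v *\<^sub>R b) = v"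
  unfolding coord_def by (rule real_vector.sum_representation_eq) (auto simp: independent_B span_B)

lemma linear_coord: "linear (coord b)"
  by (rule linearI) (simp_all add: coord_def span_B real_vector.representation_add[OF independent_B]
      real_vector.representation_scale[OF independent_B])

lemma coord_sum_eq:
  assumes "b \<in> B"
  shows "coord b (\<Sum>c\<in>B. u c *\<^sub>R c) = u b"
proof -
  have unit: "coord b c = (if c = b then 1 else 0)" if "c \<in> B" for c
    using real_vector.representation_basis[OF independent_B that] by (auto simp: coord_def)
  have "coord b (\<Sum>c\<in>B. u c *\<^sub>R c) = (\<Sum>c\<in>B. u c * coord b c)"
    by (simp add: linear_sum[OF linear_coord] linear_cmul[OF linear_coord])
  also have "\<dots> = (\<Sum>c\<in>B. if c = b then u c else 0)"
    by (rule sum.cong) (auto simp: unit)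
  finally show ?thesis using assms by simp
qed

lemma coord_bound: "\<exists>K>0. \<forall>b\<in>B. \<forall>v. \<bar>coord b v\<bar> \<le> K * norm v"
proof -
  obtain K where "K > 0" "\<And>u b. b \<in> B \<Longrightarrow> \<bar>u b\<bar> \<le> K * norm (\<Sum>b\<in>B. u b *\<^sub>R b)"
    using bounded_coordinates[OF finite_B independent_B] by blast
  then show ?thesis by (metis sum_coord)
qed

lemma bounded_linear_coord:
  assumes "b \<in> B" shows "bounded_linear (coord b)"
proof -
  obtain K where "\<And>v. \<bar>coord b v\<bar> \<le> K * norm v" using coord_bound assms by blast
  then show ?thesis
    by (intro bounded_linear_intro[of _ K]) 
       (auto simp: linear_add[OF linear_coord] linear_cmul[OF linear_coord] mult.commute)
qed

lemma linear_eq_sum_coord: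
  assumes "linear f" shows "f v = (\<Sum>b\<in>B. coord b v *\<^sub>R f b)"
proof -
  have "f v = f (\<Sum>b\<in>B. coord b v *\<^sub>R b)" by (simp add: sum_coord)
  then show ?thesis by (simp add: linear_sum[OF assms] linear_cmul[OF assms])
qed

lemma linear_imp_bounded_linear:
  fixes f :: "'a \<Rightarrow> 'b::real_normed_vector"
  assumes "linear f" shows "bounded_linear f"
proof -
  have "bounded_linear (\<lambda>v. \<Sum>b\<in>B. coord b v *\<^sub>R f b)"
    by (intro bounded_linear_sum bounded_linear_scaleR_const bounded_linear_coord)
  moreover have "f = (\<lambda>v. \<Sum>b\<in>B. coord b v *\<^sub>R f b)"
    by (rule ext) (rule linear_eq_sum_coord[OF assms])
  ultimately show ?thesis by metis
qed

end

lemma finite_dim_imp_basis: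
  assumes "finite_dim TYPE('a::real_normed_vector)"
  obtains B :: "'a::real_normed_vector set" where "finite_basis B"
proof -
  obtain S :: "'a set" where S: "finite S" "span S = UNIV"
    using assms by (auto simp: finite_dim_def)
  obtain B where B: "B \<subseteq> S" "independent B" "S \<subseteq> span B"
    using maximal_independent_subset[of S] by auto
  then have "span B = UNIV" using S(2) by (metis span_minimal subspace_span top.extremum_uniqueI)
  with B S show ?thesis using that by (metis finite_basis_def finite_subset)
qed

section \<open>Analytic maps are twice differentiable\<close>

lemma has_sum_finite_sum:
  fixes f :: "'j \<Rightarrow> 'i \<Rightarrow> real"
  assumes "finite J" "\<And>j. j \<in> J \<Longrightarrow> (f j has_sum s j) I"
  shows "((\<lambda>i. \<Sum>j\<in>J. f j i) has_sum (\<Sum>j\<in>J. s j)) I"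
  using assms by (induction J) (auto intro: has_sum_add)

text \<open>Finitely many terms carry the sum of the bounds up to an arbitrarily small rest, and the mean value
  theorem turns the bound on the derivatives into one on the differences of the remaining terms.\<close>

lemma has_derivative_has_sum:
  fixes f :: "'i \<Rightarrow> 'a::real_normed_vector \<Rightarrow> real"
  assumes S: "open S" "convex S" "x \<in> S"
    and f': "\<And>i y. i \<in> I \<Longrightarrow> y \<in> S \<Longrightarrow> (f i has_derivative f' i y) (at y)"
    and bound: "\<And>i y h. i \<in> I \<Longrightarrow> y \<in> S \<Longrightarrow> \<bar>f' i y h\<bar> \<le> M i * norm h"
    and M: "M summable_on I" "\<And>i. i \<in> I \<Longrightarrow> 0 \<le> M i"
    and g: "\<And>y. y \<in> S \<Longrightarrow> ((\<lambda>i. f i y) has_sum g y) I"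
    and g': "\<And>h. ((\<lambda>i. f' i x h) has_sum g' h) I" "bounded_linear g'"
  shows "(g has_derivative g') (at x)"
  unfolding has_derivative_within_alt
proof (intro conjI allI impI g')
  fix e :: real assume e: "e > 0"
  obtain F where F: "finite F" "F \<subseteq> I" "dist (sum M F) (infsum M I) \<le> e / 4"
    using has_sum_finite_approximation[OF has_sum_infsum[OF M(1)], of "e / 4"] e by auto
  have MF: "(M has_sum (infsum M I - sum M F)) (I - F)"
    using F M by (intro has_sum_Diff has_sum_infsum has_sum_finite) auto
  have tail: "infsum M I - sum M F \<le> e / 4" using F(3) unfolding dist_real_def by linarith
  have "((\<lambda>y. \<Sum>i\<in>F. f i y) has_derivative (\<lambda>h. \<Sum>i\<in>F. f' i x h)) (at x)"
    using F S f' by (intro has_derivative_sum) auto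
  then obtain d where d: "d > 0" "\<And>y. norm (y - x) < d \<Longrightarrow>
      \<bar>(\<Sum>i\<in>F. f i y) - (\<Sum>i\<in>F. f i x) - (\<Sum>i\<in>F. f' i x (y - x))\<bar> \<le> e / 2 * norm (y - x)"
    unfolding has_derivative_within_alt using e by (auto dest!: spec[of _ "e / 2"])
  obtain d' where d': "d' > 0" "ball x d' \<subseteq> S" using S open_contains_ball by blast
  have "\<bar>g y - g x - g' (y - x)\<bar> \<le> e * norm (y - x)" if y: "norm (y - x) < min d d'" for y
  proof -
    have yS: "y \<in> S" using y d' by (auto simp: subset_iff dist_norm norm_minus_commute)
    define r where "r i = f i y - f i x - f' i x (y - x)" for i
    have r: "(r has_sum (g y - g x - g' (y - x))) I"
      using has_sum_add[OF has_sum_add[OF g[OF yS] has_sum_uminusI[OF g[OF S(3)]]]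
          has_sum_uminusI[OF g'(1)[of "y - x"]]] by (simp add: r_def[abs_def])
    have r2: "\<bar>r i\<bar> \<le> 2 * norm (y - x) * M i" if i: "i \<in> I" for i
    proof -
      have "\<bar>f i y - f i x\<bar> \<le> M i * norm (y - x)"
        using differentiable_bound[OF S(2), of "f i" "f' i" "M i" y x] f'[OF i] yS S(3) i bound[OF i] M(2)
        by (auto simp: has_derivative_at_withinI onorm_bound)
      moreover have "\<bar>f' i x (y - x)\<bar> \<le> M i * norm (y - x)" using bound i S by blast
      ultimately show ?thesis unfolding r_def by (simp add: mult.commute)
    qed
    have rt: "(r has_sum (g y - g x - g' (y - x) - sum r F)) (I - F)"
      using F r by (intro has_sum_Diff has_sum_finite) auto
    have Mt: "((\<lambda>i. 2 * norm (y - x) * M i) has_sum (2 * norm (y - x) * (infsum M I - sum M F))) (I - F)"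
      using MF by (rule has_sum_cmult_right)
    have "r i \<le> 2 * norm (y - x) * M i" "- r i \<le> 2 * norm (y - x) * M i" if "i \<in> I - F" for i
      using r2[of i] that by (auto simp: abs_le_iff)
    then have "\<bar>g y - g x - g' (y - x) - sum r F\<bar> \<le> 2 * norm (y - x) * (infsum M I - sum M F)"
      using has_sum_mono[OF rt Mt] has_sum_mono[OF has_sum_uminusI[OF rt] Mt] by (intro abs_leI) auto
    also have "\<dots> \<le> 2 * norm (y - x) * (e / 4)" using tail by (intro mult_left_mono) auto
    finally have "\<bar>g y - g x - g' (y - x) - sum r F\<bar> \<le> e / 2 * norm (y - x)" by simp
    moreover have "\<bar>sum r F\<bar> \<le> e / 2 * norm (y - x)"
      using d(2)[of y] y by (simp add: r_def sum_subtractf)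
    ultimately show ?thesis by linarith
  qed
  then show "\<exists>d>0. \<forall>y\<in>UNIV. norm (y - x) < d \<longrightarrow> norm (g y - g x - g' (y - x)) \<le> e * norm (y - x)"
    using d(1) d'(1) by (intro exI[of _ "min d d'"]) auto
qed

text \<open>Differentiating a power series costs a factor \<open>n\<close>, which any larger radius absorbs.\<close>

lemma power_degree_bound:
  fixes s r :: real
  assumes "0 \<le> s" "s < r"
  shows "real n * s ^ (n - 1) \<le> r ^ n / (r - s)"
proof -
  have "real n * s ^ (n - 1) * (r - s) \<le> r ^ n"
  proof (induction n)
    case (Suc n)
    have "real (Suc n) * s ^ (Suc n - 1) * (r - s) = s * (real n * s ^ (n - 1) * (r - s)) + s ^ n * (r - s)"
      by (cases n) (auto simp: algebra_simps)
    also have "\<dots> \<le> s * r ^ n + r ^ n * (r - s)"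
      using assms Suc by (intro add_mono mult_left_mono mult_right_mono power_mono) auto
    finally show ?case by (simp add: algebra_simps)
  qed simp
  then show ?thesis using assms by (simp add: field_simps)
qed

context finite_basis
begin

definition monomial :: "('a \<Rightarrow> nat) \<Rightarrow> 'a \<Rightarrow> real" where
  "monomial \<alpha> v = (\<Prod>b\<in>B. coord b v ^ \<alpha> b)"

definition coord_box :: "real \<Rightarrow> 'a set" where
  "coord_box r = {v. \<forall>b\<in>B. \<bar>coord b v\<bar> < r}"

lemma coord_zero: "coord b 0 = 0"
  by (rule linear_0[OF linear_coord])

lemma open_coord_box: "open (coord_box r)"
proof -
  have "coord_box r = (\<Inter>b\<in>B. {v. \<bar>coord b v\<bar> < r})" by (auto simp: coord_box_def)
  moreover have "open {v. \<bar>coord b v\<bar> < r}" if "b \<in> B" for b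
    using bounded_linear_coord[OF that]
    by (intro open_Collect_less continuous_intros linear_continuous_on) 
  ultimately show ?thesis by auto
qed

lemma convex_coord_box: "convex (coord_box r)"
proof (rule convexI)
  fix v w :: 'a and s t :: real
  assume vw: "v \<in> coord_box r" "w \<in> coord_box r" and st: "s \<ge> 0" "t \<ge> 0" "s + t = 1"
  have "\<bar>coord b (s *\<^sub>R v + t *\<^sub>R w)\<bar> < r" if b: "b \<in> B" for b
  proof -
    have "\<bar>coord b (s *\<^sub>R v + t *\<^sub>R w)\<bar> \<le> s * \<bar>coord b v\<bar> + t * \<bar>coord b w\<bar>"
      using abs_triangle_ineq[of "s * coord b v" "t * coord b w"] st
      by (simp add: linear_add[OF linear_coord] linear_cmul[OF linear_coord] abs_mult)
    also have "\<dots> < r" 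
      using vw b st convex_bound_lt[of "\<bar>coord b v\<bar>" r "\<bar>coord b w\<bar>" s t] by (auto simp: coord_box_def)
    finally show ?thesis .
  qed
  then show "s *\<^sub>R v + t *\<^sub>R w \<in> coord_box r" by (simp add: coord_box_def)
qed

definition power_series_on :: "real \<Rightarrow> (('a \<Rightarrow> nat) \<Rightarrow> real) \<Rightarrow> ('a \<Rightarrow> real) \<Rightarrow> bool" where
  "power_series_on r c g \<longleftrightarrow> (\<forall>v\<in>coord_box r. ((\<lambda>\<alpha>. c \<alpha> * monomial \<alpha> v) has_sum g v) (B \<rightarrow>\<^sub>E UNIV))"

text \<open>The coefficients of the formal partial derivative in the direction of \<open>b\<close>.\<close>

definition partial_coeff :: "'a \<Rightarrow> (('a \<Rightarrow> nat) \<Rightarrow> real) \<Rightarrow> ('a \<Rightarrow> nat) \<Rightarrow> real" where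
  "partial_coeff b c \<alpha> = real (\<alpha> b + 1) * c (\<alpha>(b := \<alpha> b + 1))"

lemma power_series_abs_summable:
  assumes "power_series_on r c g" "0 < s" "s < r"
  shows "(\<lambda>\<alpha>. \<bar>c \<alpha>\<bar> * s ^ sum \<alpha> B) summable_on (B \<rightarrow>\<^sub>E UNIV)"
proof -
  define v where "v = (\<Sum>b\<in>B. s *\<^sub>R b)"
  have v: "coord b v = s" if "b \<in> B" for b
    unfolding v_def using coord_sum_eq[OF that, of "\<lambda>_. s"] by simp
  have "((\<lambda>\<alpha>. c \<alpha> * monomial \<alpha> v) has_sum g v) (B \<rightarrow>\<^sub>E UNIV)"
    using assms v by (auto simp: power_series_on_def coord_box_def)
  then have "(\<lambda>\<alpha>. c \<alpha> * monomial \<alpha> v) summable_on (B \<rightarrow>\<^sub>E UNIV)"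
    by (rule has_sum_imp_summable)
  then have "(\<lambda>\<alpha>. norm (c \<alpha> * monomial \<alpha> v)) summable_on (B \<rightarrow>\<^sub>E UNIV)"
    by (rule summable_on_iff_abs_summable_on_real[THEN iffD1])
  moreover have "norm (c \<alpha> * monomial \<alpha> v) = \<bar>c \<alpha>\<bar> * s ^ sum \<alpha> B" for \<alpha>
    using assms v by (simp add: monomial_def abs_mult power_sum abs_prod)
  ultimately show ?thesis by simp
qed

text \<open>For \<open>\<alpha> b = 0\<close> the factor \<open>\<alpha> b\<close> makes the value \<open>0\<close>, so the truncated exponent does no harm.\<close>

definition partial_monomial :: "'a \<Rightarrow> ('a \<Rightarrow> nat) \<Rightarrow> 'a \<Rightarrow> real" where
  "partial_monomial b \<alpha> v = real (\<alpha> b) * coord b v ^ (\<alpha> b - 1) * (\<Prod>j\<in>B - {b}. coord j v ^ \<alpha> j)"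

lemma has_derivative_monomial:
  "(monomial \<alpha> has_derivative (\<lambda>h. \<Sum>b\<in>B. coord b h * partial_monomial b \<alpha> v)) (at v)"
proof -
  have "((\<lambda>v. coord b v ^ \<alpha> b) has_derivative (\<lambda>h. real (\<alpha> b) * coord b h * coord b v ^ (\<alpha> b - 1))) (at v)"
    if "b \<in> B" for b
    using has_derivative_power[OF bounded_linear_imp_has_derivative[OF bounded_linear_coord[OF that]]]
    by (simp add: mult_ac)
  from has_derivative_prod[of B, OF this] show ?thesis
    by (simp add: monomial_def[abs_def] partial_monomial_def mult_ac)
qed

lemma partial_monomial_bound:
  assumes v: "v \<in> coord_box s" and s: "0 < s" "s < r" and b: "b \<in> B"
  shows "\<bar>partial_monomial b \<alpha> v\<bar> \<le> r ^ sum \<alpha> B / (r - s)"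
proof (cases "\<alpha> b = 0")
  case True
  then show ?thesis using s by (simp add: partial_monomial_def)
next
  case False
  have sumB: "sum \<alpha> B = \<alpha> b + sum \<alpha> (B - {b})" using b by (simp add: sum.remove)
  have le: "\<bar>coord j v\<bar> \<le> s" if "j \<in> B" for j using v that by (auto simp: coord_box_def less_imp_le)
  have "\<bar>partial_monomial b \<alpha> v\<bar> = real (\<alpha> b) * \<bar>coord b v\<bar> ^ (\<alpha> b - 1) * (\<Prod>j\<in>B - {b}. \<bar>coord j v\<bar> ^ \<alpha> j)"
    by (simp add: partial_monomial_def abs_mult abs_prod power_abs)
  also have "\<dots> \<le> real (sum \<alpha> B) * s ^ (\<alpha> b - 1) * (\<Prod>j\<in>B - {b}. s ^ \<alpha> j)"
    using le b s sumB by (intro mult_mono prod_mono power_mono conjI mult_nonneg_nonneg prod_nonneg)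
      (auto intro!: sum_nonneg add_nonneg_nonneg)
  also have "\<dots> = real (sum \<alpha> B) * s ^ (sum \<alpha> B - 1)"
    using False by (simp add: sumB power_sum[symmetric] mult.assoc power_add[symmetric])
  also have "\<dots> \<le> r ^ sum \<alpha> B / (r - s)" by (rule power_degree_bound) (use s in auto)
  finally show ?thesis .
qed

text \<open>Away from \<open>\<alpha> b = 0\<close>, where the differentiated terms vanish, raising the exponent of \<open>b\<close> by one
  is a bijective change of summation index; it turns the termwise derivative into a power series.\<close>

lemma partial_series_reindex:
  assumes b: "b \<in> B"
    and s: "((\<lambda>\<alpha>. c \<alpha> * partial_monomial b \<alpha> v) has_sum s) (B \<rightarrow>\<^sub>E UNIV)"
  shows "((\<lambda>\<alpha>. partial_coeff b c \<alpha> * monomial \<alpha> v) has_sum s) (B \<rightarrow>\<^sub>E UNIV)"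
proof -
  let ?up = "\<lambda>\<alpha>::'a \<Rightarrow> nat. \<alpha>(b := \<alpha> b + 1)"
  have "((\<lambda>\<alpha>. c \<alpha> * partial_monomial b \<alpha> v) has_sum s) {\<alpha> \<in> B \<rightarrow>\<^sub>E UNIV. \<alpha> b \<noteq> 0}"
    by (rule has_sum_cong_neutral[THEN iffD1, OF _ _ _ s]) (auto simp: partial_monomial_def)
  moreover have "partial_coeff b c \<alpha> * monomial \<alpha> v = c (?up \<alpha>) * partial_monomial b (?up \<alpha>) v" for \<alpha>
  proof -
    have "monomial \<alpha> v = coord b v ^ \<alpha> b * (\<Prod>j\<in>B - {b}. coord j v ^ \<alpha> j)"
      using b by (simp add: monomial_def prod.remove)
    moreover have "(\<Prod>j\<in>B - {b}. coord j v ^ (?up \<alpha>) j) = (\<Prod>j\<in>B - {b}. coord j v ^ \<alpha> j)"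
      by (intro prod.cong) auto
    ultimately show ?thesis by (simp add: partial_coeff_def partial_monomial_def)
  qed
  ultimately show ?thesis
    using b by (subst has_sum_reindex_bij_witness[where T="{\<alpha> \<in> B \<rightarrow>\<^sub>E UNIV. \<alpha> b \<noteq> 0}" and j="?up"
        and i="\<lambda>\<alpha>. \<alpha>(b := \<alpha> b - 1)" and h="\<lambda>\<alpha>. c \<alpha> * partial_monomial b \<alpha> v"])
      (auto simp: PiE_iff extensional_def)
qed

lemma power_series_has_derivative:
  assumes g: "power_series_on r c g" 
  shows "\<exists>G. (\<forall>b\<in>B. power_series_on r (partial_coeff b c) (G b)) \<and>
    (\<forall>v\<in>coord_box r. (g has_derivative (\<lambda>h. \<Sum>b\<in>B. coord b h * G b v)) (at v))"
proof -
  define G where "G b v = infsum (\<lambda>\<alpha>. c \<alpha> * partial_monomial b \<alpha> v) (B \<rightarrow>\<^sub>E UNIV)" for b v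
  have main: "(\<forall>b\<in>B. ((\<lambda>\<alpha>. c \<alpha> * partial_monomial b \<alpha> v) has_sum G b v) (B \<rightarrow>\<^sub>E UNIV)) \<and>
      (g has_derivative (\<lambda>h. \<Sum>b\<in>B. coord b h * G b v)) (at v)" if v: "v \<in> coord_box r" for v
  proof (cases "B = {}")
    case True
    have zero: "w = 0" for w :: 'a using sum_coord[of w] True by simp
    have "g = (\<lambda>_. g 0)" by (rule ext) (rule arg_cong[OF zero])
    then have "(g has_derivative (\<lambda>h. 0)) (at v)" by (metis has_derivative_const)
    then show ?thesis using True by simp
  next
    case False
    \<comment> \<open>The terms are bounded on the box of radius \<open>s\<close>, with slack up to \<open>s'\<close> for the factor lost in
      differentiating, while the coefficients are still summable at \<open>s' < r\<close>.\<close>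
    define q where "q = Max ((\<lambda>b. \<bar>coord b v\<bar>) ` B)"
    have q: "\<bar>coord b v\<bar> \<le> q" if "b \<in> B" for b unfolding q_def using that by auto
    have "q < r" using v False by (auto simp: q_def coord_box_def)
    moreover have "q \<ge> 0" using q False by force
    ultimately obtain s where s: "q < s" "s < r" "0 < s" by (meson dense le_less_trans)
    obtain s' where s': "s < s'" "s' < r" using s dense by blast
    have vs: "v \<in> coord_box s" using q s by (force simp: coord_box_def)
    obtain K where K: "K > 0" "\<And>b v. b \<in> B \<Longrightarrow> \<bar>coord b v\<bar> \<le> K * norm v"
      using coord_bound by blast
    define N where "N \<alpha> = \<bar>c \<alpha>\<bar> * s' ^ sum \<alpha> B / (s' - s)" for \<alpha>
    have N: "N summable_on (B \<rightarrow>\<^sub>E UNIV)"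
      unfolding N_def using power_series_abs_summable[OF g, of s'] s s' 
      by (simp add: divide_inverse summable_on_cmult_left)
    have N0: "N \<alpha> \<ge> 0" for \<alpha> using s s' by (simp add: N_def)
    have le: "\<bar>c \<alpha> * partial_monomial b \<alpha> w\<bar> \<le> N \<alpha>" if "w \<in> coord_box s" "b \<in> B" for \<alpha> b w
      using mult_left_mono[OF partial_monomial_bound[OF that(1) s(3) s'(1) that(2)], of "\<bar>c \<alpha>\<bar>" \<alpha>]
      by (simp add: N_def abs_mult)
    have sum: "((\<lambda>\<alpha>. c \<alpha> * partial_monomial b \<alpha> v) has_sum G b v) (B \<rightarrow>\<^sub>E UNIV)" if "b \<in> B" for b
    proof -
      have "(\<lambda>\<alpha>. norm (c \<alpha> * partial_monomial b \<alpha> v)) summable_on (B \<rightarrow>\<^sub>E UNIV)"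
        using N by (rule summable_on_comparison_test) (use le[OF vs that] in auto)
      then have "(\<lambda>\<alpha>. c \<alpha> * partial_monomial b \<alpha> v) summable_on (B \<rightarrow>\<^sub>E UNIV)"
        by (rule summable_on_iff_abs_summable_on_real[THEN iffD2])
      then show ?thesis unfolding G_def by (rule has_sum_infsum)
    qed
    have "(g has_derivative (\<lambda>h. \<Sum>b\<in>B. coord b h * G b v)) (at v)"
    proof (rule has_derivative_has_sum[OF open_coord_box convex_coord_box vs, where I="B \<rightarrow>\<^sub>E UNIV"
          and f="\<lambda>\<alpha> w. c \<alpha> * monomial \<alpha> w"
          and f'="\<lambda>\<alpha> w h. c \<alpha> * (\<Sum>b\<in>B. coord b h * partial_monomial b \<alpha> w)"
          and M="\<lambda>\<alpha>. (real (card B) * K) * N \<alpha>"])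
      show "((\<lambda>w. c \<alpha> * monomial \<alpha> w) has_derivative
          (\<lambda>h. c \<alpha> * (\<Sum>b\<in>B. coord b h * partial_monomial b \<alpha> w))) (at w)" for \<alpha> w
        by (intro has_derivative_mult_right has_derivative_monomial)
      show "\<bar>c \<alpha> * (\<Sum>b\<in>B. coord b h * partial_monomial b \<alpha> w)\<bar> \<le> real (card B) * K * N \<alpha> * norm h"
        if w: "w \<in> coord_box s" for \<alpha> w h
      proof -
        have "c \<alpha> * (\<Sum>b\<in>B. coord b h * partial_monomial b \<alpha> w)
            = (\<Sum>b\<in>B. coord b h * (c \<alpha> * partial_monomial b \<alpha> w))"
          by (simp add: sum_distrib_left mult_ac)
        also have "\<bar>\<dots>\<bar> \<le> (\<Sum>b\<in>B. \<bar>coord b h * (c \<alpha> * partial_monomial b \<alpha> w)\<bar>)" by (rule sum_abs)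
        also have "\<dots> \<le> (\<Sum>b\<in>B. (K * norm h) * N \<alpha>)"
          unfolding abs_mult[of "coord _ h"] using K le[OF w]
          by (intro sum_mono mult_mono) auto
        finally show ?thesis by (simp add: mult_ac)
      qed
      show "(\<lambda>\<alpha>. real (card B) * K * N \<alpha>) summable_on (B \<rightarrow>\<^sub>E UNIV)"
        using N by (rule summable_on_cmult_right)
      show "0 \<le> real (card B) * K * N \<alpha>" for \<alpha> using K N0 by simp
      show "((\<lambda>\<alpha>. c \<alpha> * monomial \<alpha> w) has_sum g w) (B \<rightarrow>\<^sub>E UNIV)" if "w \<in> coord_box s" for w
      proof -
        have "w \<in> coord_box r" using that s by (force simp: coord_box_def)
        then show ?thesis using g by (simp add: power_series_on_def)
      qed
      show "((\<lambda>\<alpha>. c \<alpha> * (\<Sum>b\<in>B. coord b h * partial_monomial b \<alpha> v)) has_sum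
          (\<Sum>b\<in>B. coord b h * G b v)) (B \<rightarrow>\<^sub>E UNIV)" for h
      proof -
        have "((\<lambda>\<alpha>. \<Sum>b\<in>B. coord b h * (c \<alpha> * partial_monomial b \<alpha> v)) has_sum
          (\<Sum>b\<in>B. coord b h * G b v)) (B \<rightarrow>\<^sub>E UNIV)"
          by (intro has_sum_finite_sum has_sum_cmult_right sum finite_B)
        then show ?thesis by (simp add: sum_distrib_left mult_ac)
      qed
      show "bounded_linear (\<lambda>h. \<Sum>b\<in>B. coord b h * G b v)"
        by (intro bounded_linear_sum bounded_linear_mult_const bounded_linear_coord)
    qed
    with sum show ?thesis by blast
  qed
  then show ?thesis
    by (intro exI[of _ G]) (auto simp: power_series_on_def intro: partial_series_reindex)
qed

lemma power_series_at_0: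
  assumes "power_series_on r c g" "r > 0"
  shows "g 0 = c (\<lambda>b\<in>B. 0)"
proof -
  let ?z = "\<lambda>b\<in>B. 0::nat"
  have "((\<lambda>\<alpha>. c \<alpha> * monomial \<alpha> 0) has_sum g 0) (B \<rightarrow>\<^sub>E UNIV)"
    using assms by (auto simp: power_series_on_def coord_box_def coord_zero)
  moreover have "((\<lambda>\<alpha>. c \<alpha> * monomial \<alpha> 0) has_sum c ?z) (B \<rightarrow>\<^sub>E UNIV)"
  proof (rule has_sum_finite_neutralI[of "{?z}"])
    show "c \<alpha> * monomial \<alpha> 0 = 0" if "\<alpha> \<in> (B \<rightarrow>\<^sub>E UNIV) - {?z}" for \<alpha>
    proof -
      have "\<exists>b\<in>B. \<alpha> b \<noteq> 0"
      proof (rule ccontr)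
        assume "\<not> ?thesis"
        then have "\<alpha> b = ?z b" for b using that by (auto simp: PiE_iff extensional_def)
        then show False using that by auto
      qed
      then have "monomial \<alpha> 0 = 0" by (auto simp: monomial_def coord_zero)
      then show ?thesis by simp
    qed
  qed (auto simp: monomial_def coord_zero)
  ultimately show ?thesis by (rule has_sum_unique)
qed

text \<open>With \<open>power_series_at_0\<close>, this is the symmetry of the second partial derivatives at \<open>0\<close>.\<close>

lemma partial_coeff_commute:
  assumes "b \<in> B" "d \<in> B"
  shows "partial_coeff d (partial_coeff b c) (\<lambda>b\<in>B. 0) = partial_coeff b (partial_coeff d c) (\<lambda>b\<in>B. 0)"
  using assms by (cases "b = d") (auto simp: partial_coeff_def fun_upd_twist)

end

text \<open>The second derivative is taken after applying the first one to a fixed vector, so that no norm on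
  the space of linear maps is involved.\<close>

definition second_order_data ::
    "('a::real_normed_vector \<Rightarrow> 'b::real_normed_vector) \<Rightarrow> 'a \<Rightarrow> 'a set \<Rightarrow> ('a \<Rightarrow> 'a \<Rightarrow> 'b) \<Rightarrow> ('a \<Rightarrow> 'a \<Rightarrow> 'b) \<Rightarrow> bool"
  where
  "second_order_data f x S f' f'' \<longleftrightarrow> open S \<and> x \<in> S \<and> (\<forall>y\<in>S. (f has_derivative f' y) (at y)) \<and>
     (\<forall>v. ((\<lambda>y. f' y v) has_derivative f'' v) (at x)) \<and> (\<forall>v w. f'' v w = f'' w v)"

definition twice_differentiable_at ::
    "('a::real_normed_vector \<Rightarrow> 'b::real_normed_vector) \<Rightarrow> 'a \<Rightarrow> bool" where
  "twice_differentiable_at f x \<longleftrightarrow> (\<exists>S f' f''. second_order_data f x S f' f'')"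

lemma twice_differentiable_atI:
  assumes "open S" "x \<in> S" "\<And>y. y \<in> S \<Longrightarrow> (f has_derivative f' y) (at y)"
    and "\<And>v. ((\<lambda>y. f' y v) has_derivative f'' v) (at x)" "\<And>v w. f'' v w = f'' w v"
  shows "twice_differentiable_at f x"
proof -
  have "second_order_data f x S f' f''" unfolding second_order_data_def using assms by blast
  then show ?thesis unfolding twice_differentiable_at_def by blast
qed

lemma twice_differentiable_atE:
  assumes "twice_differentiable_at f x"
  obtains S f' f'' where "open S" "x \<in> S" "\<And>y. y \<in> S \<Longrightarrow> (f has_derivative f' y) (at y)"
    and "\<And>v. ((\<lambda>y. f' y v) has_derivative f'' v) (at x)" "\<And>v w. f'' v w = f'' w v"
proof -
  obtain S f' f'' where "second_order_data f x S f' f''"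
    using assms unfolding twice_differentiable_at_def by blast
  then show ?thesis unfolding second_order_data_def by (intro that[of S f' f'']) blast+
qed

lemma twice_differentiable_at_cong:
  assumes "twice_differentiable_at f x" "open T" "x \<in> T" "\<And>y. y \<in> T \<Longrightarrow> f y = g y"
  shows "twice_differentiable_at g x"
proof -
  obtain S f' f'' where S: "open S" "x \<in> S" and f': "\<And>y. y \<in> S \<Longrightarrow> (f has_derivative f' y) (at y)"
    and f'': "\<And>v. ((\<lambda>y. f' y v) has_derivative f'' v) (at x)" "\<And>v w. f'' v w = f'' w v"
    by (rule twice_differentiable_atE[OF assms(1)]) (rule that)
  have "(g has_derivative f' y) (at y)" if "y \<in> S \<inter> T" for y
    using that by (intro has_derivative_transform_within_open[OF f' assms(2) _ assms(4)]) blast+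
  then show ?thesis
    using S assms(2,3) f'' by (intro twice_differentiable_atI[of "S \<inter> T" x g f' f'']) blast+
qed

lemma twice_differentiable_at_shift:
  assumes "twice_differentiable_at f 0"
  shows "twice_differentiable_at (\<lambda>y. f (y - x)) x"
proof -
  obtain S f' f'' where S: "open S" "0 \<in> S" and f': "\<And>y. y \<in> S \<Longrightarrow> (f has_derivative f' y) (at y)"
    and f'': "\<And>v. ((\<lambda>y. f' y v) has_derivative f'' v) (at 0)" "\<And>v w. f'' v w = f'' w v"
    by (rule twice_differentiable_atE[OF assms(1)]) (rule that)
  have shift: "((\<lambda>y. h (y - x)) has_derivative h') (at y)" if "(h has_derivative h') (at (y - x))" 
    for h :: "'a \<Rightarrow> 'c::real_normed_vector" and h' y
  proof -
    have "((\<lambda>y. y - x) has_derivative (\<lambda>v. v)) (at y)" by (auto intro!: derivative_eq_intros)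
    from has_derivative_compose[OF this that] show ?thesis .
  qed
  have "open ((\<lambda>y. y - x) -` S)" using S(1) by (intro open_vimage continuous_intros)
  then show ?thesis
  proof (intro twice_differentiable_atI[of "(\<lambda>y. y - x) -` S" x _ "\<lambda>y. f' (y - x)" f''])
    show "f'' v w = f'' w v" for v w by (rule f''(2))
    show "((\<lambda>y. f (y - x)) has_derivative f' (y - x)) (at y)" if "y \<in> (\<lambda>y. y - x) -` S" for y
      using that by (intro shift f') simp
    show "((\<lambda>y. f' (y - x) v) has_derivative f'' v) (at x)" for v
      using f''(1)[of v] by (intro shift[of "\<lambda>y. f' y v"]) simp
  qed (use S(2) in auto)
qed

lemma twice_differentiable_at_scaleR_sum:
  fixes f :: "'d \<Rightarrow> 'a::real_normed_vector \<Rightarrow> real"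
  assumes "finite D" "\<And>d. d \<in> D \<Longrightarrow> twice_differentiable_at (f d) x"
  shows "twice_differentiable_at (\<lambda>y. \<Sum>d\<in>D. f d y *\<^sub>R w d) x"
proof -
  have "\<forall>d\<in>D. \<exists>T. second_order_data (f d) x (fst T) (fst (snd T)) (snd (snd T))"
    using assms(2) unfolding twice_differentiable_at_def by simp
  from bchoice[OF this] obtain T where
    T: "\<forall>d\<in>D. second_order_data (f d) x (fst (T d)) (fst (snd (T d))) (snd (snd (T d)))" ..
  define S f' f'' where "S d = fst (T d)" and "f' d = fst (snd (T d))" and "f'' d = snd (snd (T d))" for d
  have S: "\<And>d. d \<in> D \<Longrightarrow> open (S d)" "\<And>d. d \<in> D \<Longrightarrow> x \<in> S d" 
    and f': "\<And>d y. d \<in> D \<Longrightarrow> y \<in> S d \<Longrightarrow> (f d has_derivative f' d y) (at y)"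
    and f'': "\<And>d v. d \<in> D \<Longrightarrow> ((\<lambda>y. f' d y v) has_derivative f'' d v) (at x)" 
      "\<And>d v w. d \<in> D \<Longrightarrow> f'' d v w = f'' d w v"
    using T unfolding S_def f'_def f''_def second_order_data_def by blast+
  show ?thesis
  proof (rule twice_differentiable_atI)
    show "open (\<Inter>d\<in>D. S d)" "x \<in> (\<Inter>d\<in>D. S d)" using S assms(1) by auto
    show "((\<lambda>y. \<Sum>d\<in>D. f d y *\<^sub>R w d) has_derivative (\<lambda>v. \<Sum>d\<in>D. f' d y v *\<^sub>R w d)) (at y)"
      if "y \<in> (\<Inter>d\<in>D. S d)" for y
      using that f' by (intro has_derivative_sum has_derivative_scaleR_left) auto
    show "((\<lambda>y. \<Sum>d\<in>D. f' d y v *\<^sub>R w d) has_derivative (\<lambda>u. \<Sum>d\<in>D. f'' d v u *\<^sub>R w d)) (at x)" for v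
      using f''(1) by (intro has_derivative_sum has_derivative_scaleR_left) auto
    show "(\<Sum>d\<in>D. f'' d v u *\<^sub>R w d) = (\<Sum>d\<in>D. f'' d u v *\<^sub>R w d)" for u v
      by (rule sum.cong[OF refl]) (simp only: f''(2)[of _ u v])
  qed
qed

lemma (in finite_basis) power_series_twice_differentiable:
  assumes g: "power_series_on r c g" and r: "r > 0"
  shows "twice_differentiable_at g 0"
proof -
  obtain G where G: "\<And>b. b \<in> B \<Longrightarrow> power_series_on r (partial_coeff b c) (G b)"
      "\<And>v. v \<in> coord_box r \<Longrightarrow> (g has_derivative (\<lambda>h. \<Sum>b\<in>B. coord b h * G b v)) (at v)"
    using power_series_has_derivative[OF g] by blast
  have "\<forall>b\<in>B. \<exists>H. (\<forall>d\<in>B. power_series_on r (partial_coeff d (partial_coeff b c)) (H d)) \<and>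
    (\<forall>v\<in>coord_box r. (G b has_derivative (\<lambda>h. \<Sum>d\<in>B. coord d h * H d v)) (at v))"
    by (intro ballI power_series_has_derivative G(1))
  from bchoice[OF this] obtain H where
    "\<forall>b\<in>B. (\<forall>d\<in>B. power_series_on r (partial_coeff d (partial_coeff b c)) (H b d)) \<and>
      (\<forall>v\<in>coord_box r. (G b has_derivative (\<lambda>h. \<Sum>d\<in>B. coord d h * H b d v)) (at v))" ..
  then have H: "\<And>b d. b \<in> B \<Longrightarrow> d \<in> B \<Longrightarrow> power_series_on r (partial_coeff d (partial_coeff b c)) (H b d)"
     "\<And>b v. b \<in> B \<Longrightarrow> v \<in> coord_box r \<Longrightarrow> (G b has_derivative (\<lambda>h. \<Sum>d\<in>B. coord d h * H b d v)) (at v)"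
    by blast+
  have 0: "0 \<in> coord_box r" using r by (simp add: coord_box_def coord_zero)
  have sym: "H b d 0 = H d b 0" if "b \<in> B" "d \<in> B" for b d
    using that by (simp add: power_series_at_0[OF H(1) r] partial_coeff_commute)
  show ?thesis
  proof (rule twice_differentiable_atI)
    show "(g has_derivative (\<lambda>h. \<Sum>b\<in>B. coord b h * G b y)) (at y)" if "y \<in> coord_box r" for y
      using G(2) that .
    show "((\<lambda>y. \<Sum>b\<in>B. coord b v * G b y) has_derivative
        (\<lambda>h. \<Sum>b\<in>B. coord b v * (\<Sum>d\<in>B. coord d h * H b d 0))) (at 0)" for v
      using H(2) 0 by (intro has_derivative_sum has_derivative_mult_right) auto
    show "(\<Sum>b\<in>B. coord b v * (\<Sum>d\<in>B. coord d w * H b d 0))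
        = (\<Sum>b\<in>B. coord b w * (\<Sum>d\<in>B. coord d v * H b d 0))" for v w
    proof -
      have "(\<Sum>b\<in>B. coord b v * (\<Sum>d\<in>B. coord d w * H b d 0))
          = (\<Sum>d\<in>B. \<Sum>b\<in>B. coord b v * coord d w * H b d 0)"
        by (simp add: sum_distrib_left mult.assoc) (rule sum.swap)
      also have "\<dots> = (\<Sum>b\<in>B. coord b w * (\<Sum>d\<in>B. coord d v * H b d 0))"
        unfolding sum_distrib_left by (intro sum.cong refl) (auto simp: sym mult_ac)
      finally show ?thesis .
    qed
  qed (use 0 open_coord_box in auto)
qed

text \<open>Coordinates in the target reduce this to real power series, where convergence is absolute.\<close>

lemma real_analytic_twice_differentiable:
  fixes f :: "'a::real_normed_vector \<Rightarrow> 'b::real_normed_vector"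
  assumes f: "real_analytic_at f x" and fin: "finite_dim TYPE('b)"
  shows "twice_differentiable_at f x"
proof -
  obtain B r and c :: "('a \<Rightarrow> nat) \<Rightarrow> 'b" where B: "finite B" "independent B" "span B = UNIV" and r: "r > 0"
    and c: "\<And>u::'a \<Rightarrow> real. \<forall>b\<in>B. \<bar>u b\<bar> < r \<Longrightarrow>
           ((\<lambda>\<alpha>. (\<Prod>b\<in>B. u b ^ \<alpha> b) *\<^sub>R c \<alpha>) has_sum f (x + (\<Sum>b\<in>B. u b *\<^sub>R b))) (B \<rightarrow>\<^sub>E UNIV)"
    using f unfolding real_analytic_at_def by blast
  interpret B: finite_basis B using B by unfold_locales
  obtain D :: "'b set" where "finite_basis D" using finite_dim_imp_basis[OF fin] .
  then interpret D: finite_basis D .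
  have "twice_differentiable_at (\<lambda>y. D.coord d (f y)) x" if d: "d \<in> D" for d
  proof -
    have "B.power_series_on r (\<lambda>\<alpha>. D.coord d (c \<alpha>)) (\<lambda>v. D.coord d (f (x + v)))"
      unfolding B.power_series_on_def
    proof
      fix v assume "v \<in> B.coord_box r"
      then have "((\<lambda>\<alpha>. (\<Prod>b\<in>B. B.coord b v ^ \<alpha> b) *\<^sub>R c \<alpha>) has_sum f (x + v)) (B \<rightarrow>\<^sub>E UNIV)"
        using c[of "\<lambda>b. B.coord b v"] by (simp add: B.coord_box_def B.sum_coord)
      from has_sum_bounded_linear[OF D.bounded_linear_coord[OF d] this]
      show "((\<lambda>\<alpha>. D.coord d (c \<alpha>) * B.monomial \<alpha> v) has_sum D.coord d (f (x + v))) (B \<rightarrow>\<^sub>E UNIV)"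
        by (simp add: linear_cmul[OF D.linear_coord] B.monomial_def mult.commute)
    qed
    from twice_differentiable_at_shift[OF B.power_series_twice_differentiable[OF this r], of x]
    show ?thesis by simp
  qed
  then have "twice_differentiable_at (\<lambda>y. \<Sum>d\<in>D. D.coord d (f y) *\<^sub>R d) x"
    by (rule twice_differentiable_at_scaleR_sum[OF D.finite_B])
  then show ?thesis by (simp add: D.sum_coord)
qed

text \<open>For maps into operators, pointwise differentiability suffices: in coordinates the argument is a
  finite combination of fixed vectors.\<close>

lemma (in finite_basis) has_derivative_apply:
  fixes N :: "'c::real_normed_vector \<Rightarrow> 'a \<Rightarrow> 'b::real_normed_vector"
  assumes N: "\<And>u. ((\<lambda>z. N z u) has_derivative N' u) (at p)"
    and lin: "open S" "p \<in> S" "\<And>z. z \<in> S \<Longrightarrow> linear (N z)"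
    and f: "(f has_derivative f') (at p)"
  shows "((\<lambda>z. N z (f z)) has_derivative (\<lambda>h. N p (f' h) + N' (f p) h)) (at p)"
proof -
  have N'_eq: "N' u h = (\<Sum>b\<in>B. coord b u *\<^sub>R N' b h)" for u h
  proof -
    have "((\<lambda>z. \<Sum>b\<in>B. coord b u *\<^sub>R N z b) has_derivative (\<lambda>h. \<Sum>b\<in>B. coord b u *\<^sub>R N' b h)) (at p)"
      using N by (intro has_derivative_sum has_derivative_scaleR_right)
    then have "((\<lambda>z. N z u) has_derivative (\<lambda>h. \<Sum>b\<in>B. coord b u *\<^sub>R N' b h)) (at p)"
      by (rule has_derivative_transform_within_open[OF _ lin(1,2)]) 
        (simp add: linear_eq_sum_coord[OF lin(3), symmetric])
    from has_derivative_unique[OF N this] show ?thesis by metis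
  qed
  have "((\<lambda>z. coord b (f z)) has_derivative (\<lambda>h. coord b (f' h))) (at p)" if "b \<in> B" for b
    using bounded_linear.has_derivative[OF bounded_linear_coord[OF that] f] .
  then have "((\<lambda>z. \<Sum>b\<in>B. coord b (f z) *\<^sub>R N z b) has_derivative
      (\<lambda>h. \<Sum>b\<in>B. coord b (f p) *\<^sub>R N' b h + coord b (f' h) *\<^sub>R N p b)) (at p)"
    using N by (intro has_derivative_sum has_derivative_scaleR) auto
  also have "(\<lambda>h. \<Sum>b\<in>B. coord b (f p) *\<^sub>R N' b h + coord b (f' h) *\<^sub>R N p b) = (\<lambda>h. N p (f' h) + N' (f p) h)"
    by (simp add: sum.distrib N'_eq[of "f p", symmetric] linear_eq_sum_coord[OF lin(3)[OF lin(2)], symmetric] add.commute)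
  finally show ?thesis
    by (rule has_derivative_transform_within_open[OF _ lin(1,2)])
      (simp add: linear_eq_sum_coord[OF lin(3), symmetric])
qed

section \<open>Powers in a Moufang loop\<close>

definition inner_map :: "('m \<Rightarrow> 'm \<Rightarrow> 'm) \<Rightarrow> 'm \<Rightarrow> 'm \<Rightarrow> 'm" where
  "inner_map m a b = right_div m (m a b) a"

lemma right_div_mult:
  assumes "is_loop m e"
  shows "m (right_div m b a) a = b"
  unfolding right_div_def by (rule theI') (use assms in \<open>auto simp: is_loop_def\<close>)

lemma right_div_unique:
  assumes "is_loop m e" "m c a = b"
  shows "right_div m b a = c"
  using assms right_div_mult[OF assms(1)] unfolding is_loop_def by metis

lemma inner_map_mult: "is_loop m e \<Longrightarrow> m (inner_map m a b) a = m a b"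
  unfolding inner_map_def by (rule right_div_mult)

lemma inner_map_e:
  assumes "is_loop m e" shows "inner_map m a e = e" "inner_map m e b = b"
  using assms unfolding inner_map_def by (auto intro!: right_div_unique simp: is_loop_def)

text \<open>The left and the right Moufang identity describe multiplication by \<open>(a b) a\<close> and \<open>a (b a)\<close>; hence a
  recursion that adds one factor on each side.\<close>

fun loop_power :: "('m \<Rightarrow> 'm \<Rightarrow> 'm) \<Rightarrow> 'm \<Rightarrow> 'm \<Rightarrow> nat \<Rightarrow> 'm" where
  "loop_power m e a 0 = e"
| "loop_power m e a (Suc 0) = a"
| "loop_power m e a (Suc (Suc n)) = m (m a (loop_power m e a n)) a"

lemma moufang_left: "moufang_loop m e \<Longrightarrow> m (m (m a b) a) c = m a (m b (m a c))"
  and moufang_right: "moufang_loop m e \<Longrightarrow> m c (m a (m b a)) = m (m (m c a) b) a"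
  and moufang_middle: "moufang_loop m e \<Longrightarrow> m (m a (m b c)) a = m (m a b) (m c a)"
  unfolding moufang_loop_def by auto

lemma moufang_flexible:
  assumes "moufang_loop m e"
  shows "m a (m b a) = m (m a b) a"
  using moufang_middle[OF assms, of a e b] assms unfolding moufang_loop_def is_loop_def by simp

lemma left_mult_loop_power:
  assumes "moufang_loop m e"
  shows "m (loop_power m e a n) c = (m a ^^ n) c"
  using assms
proof (induction m e a n arbitrary: c rule: loop_power.induct)
  case (3 m e a n)
  have "m (loop_power m e a (Suc (Suc n))) c = m a (m (loop_power m e a n) (m a c))"
    by (simp add: moufang_left[OF 3(2)])
  also have "\<dots> = m a ((m a ^^ n) (m a c))" by (simp only: 3)
  finally show ?case by (simp add: funpow_swap1)
qed (auto simp: moufang_loop_def is_loop_def)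

lemma right_mult_loop_power:
  assumes "moufang_loop m e"
  shows "m c (loop_power m e a n) = ((\<lambda>x. m x a) ^^ n) c"
  using assms
proof (induction m e a n arbitrary: c rule: loop_power.induct)
  case (3 m e a n)
  have "m c (loop_power m e a (Suc (Suc n))) = m (m (m c a) (loop_power m e a n)) a"
    by (simp only: loop_power.simps moufang_flexible[OF 3(2), symmetric] moufang_right[OF 3(2)])
  also have "\<dots> = m (((\<lambda>x. m x a) ^^ n) (m c a)) a" by (simp only: 3)
  finally show ?case using funpow_swap1[of "\<lambda>x. m x a" n c] by simp
qed (auto simp: moufang_loop_def is_loop_def)

text \<open>Left and right multiplication by \<open>a\<close> commute, so the powers of their quotient are the quotients
  of their powers, and those are the multiplications by the powers of \<open>a\<close>.\<close>

lemma inner_map_loop_power: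
  assumes "moufang_loop m e"
  shows "inner_map m (loop_power m e a n) = inner_map m a ^^ n"
proof
  fix c
  have loop: "is_loop m e" using assms by (simp add: moufang_loop_def)
  have comm: "((\<lambda>x. m x a) ^^ n) (m a y) = m a (((\<lambda>x. m x a) ^^ n) y)" for n y
    by (induction n) (simp_all add: moufang_flexible[OF assms])
  have "((\<lambda>x. m x a) ^^ n) ((inner_map m a ^^ n) c) = (m a ^^ n) c"
  proof (induction n)
    case (Suc n)
    have "((\<lambda>x. m x a) ^^ Suc n) ((inner_map m a ^^ Suc n) c)
        = ((\<lambda>x. m x a) ^^ n) (m (inner_map m a ((inner_map m a ^^ n) c)) a)"
      using funpow_swap1[of "\<lambda>x. m x a" n] by simp
    also have "\<dots> = m a (((\<lambda>x. m x a) ^^ n) ((inner_map m a ^^ n) c))"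
      by (simp only: inner_map_mult[OF loop] comm)
    finally show ?case using Suc by simp
  qed simp
  then show "inner_map m (loop_power m e a n) c = (inner_map m a ^^ n) c"
    unfolding inner_map_def[of m "loop_power m e a n"] left_mult_loop_power[OF assms]
    by (intro right_div_unique[OF loop]) (simp add: right_mult_loop_power[OF assms])
qed

section \<open>The adjoint action of an analytic Moufang loop\<close>

text \<open>\<open>G1 u\<close> and \<open>G2 v\<close> are derivatives of the partial derivatives \<open>F1\<close> and \<open>F2\<close> applied to \<open>u\<close> and to \<open>v\<close>;
  the last equation is the equality of the mixed ones.\<close>

lemma partial_derivatives:
  fixes F :: "'a::real_normed_vector \<Rightarrow> 'b::real_normed_vector \<Rightarrow> 'c::real_normed_vector"
  assumes "twice_differentiable_at (\<lambda>(z, y). F z y) (z0, y0)"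
  obtains S F1 F2 G1 G2 where "open S" "(z0, y0) \<in> S"
    "\<And>z y. (z, y) \<in> S \<Longrightarrow> ((\<lambda>z. F z y) has_derivative F1 z y) (at z)"
    "\<And>z y. (z, y) \<in> S \<Longrightarrow> ((\<lambda>y. F z y) has_derivative F2 z y) (at y)"
    "\<And>u. ((\<lambda>(z, y). F1 z y u) has_derivative G1 u) (at (z0, y0))"
    "\<And>v. ((\<lambda>(z, y). F2 z y v) has_derivative G2 v) (at (z0, y0))"
    "\<And>u v. G1 u (0, v) = G2 v (u, 0)"
proof -
  obtain S f' f'' where S: "open S" "(z0, y0) \<in> S" 
    and f': "\<And>q. q \<in> S \<Longrightarrow> ((\<lambda>(z, y). F z y) has_derivative f' q) (at q)"
    and f'': "\<And>v. ((\<lambda>q. f' q v) has_derivative f'' v) (at (z0, y0))" "\<And>v w. f'' v w = f'' w v"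
    by (rule twice_differentiable_atE[OF assms(1)]) (rule that)
  show thesis
  proof (rule that[OF S, of "\<lambda>z y u. f' (z, y) (u, 0)" "\<lambda>z y v. f' (z, y) (0, v)" "\<lambda>u. f'' (u, 0)" "\<lambda>v. f'' (0, v)"])
    fix z y assume zy: "(z, y) \<in> S"
    have "((\<lambda>z. (z, y)) has_derivative (\<lambda>u. (u, 0))) (at z)"
      by (intro has_derivative_Pair has_derivative_const has_derivative_ident)
    from has_derivative_compose[OF this f'[OF zy]]
    show "((\<lambda>z. F z y) has_derivative (\<lambda>u. f' (z, y) (u, 0))) (at z)" by simp
    have "((\<lambda>y. (z, y)) has_derivative (\<lambda>v. (0, v))) (at y)"
      by (intro has_derivative_Pair has_derivative_const has_derivative_ident)
    from has_derivative_compose[OF this f'[OF zy]]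
    show "((\<lambda>y. F z y) has_derivative (\<lambda>v. f' (z, y) (0, v))) (at y)" by simp
  next
    fix u show "((\<lambda>(z, y). f' (z, y) (u, 0)) has_derivative f'' (u, 0)) (at (z0, y0))"
      using f''(1)[of "(u, 0)"] by (simp add: split_def)
  next
    fix v show "((\<lambda>(z, y). f' (z, y) (0, v)) has_derivative f'' (0, v)) (at (z0, y0))"
      using f''(1)[of "(0, v)"] by (simp add: split_def)
  next
    show "f'' (u, 0) (0, v) = f'' (0, v) (u, 0)" for u v by (rule f''(2))
  qed
qed

lemma chart_facts:
  assumes "is_chart \<kappa>"
  shows open_chart_domain: "open (fst \<kappa>)"
    and open_chart_image: "open (snd \<kappa> ` fst \<kappa>)"
    and chart_inv_in: "z \<in> snd \<kappa> ` fst \<kappa> \<Longrightarrow> chart_inv \<kappa> z \<in> fst \<kappa>"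
    and chart_inv_left: "a \<in> fst \<kappa> \<Longrightarrow> chart_inv \<kappa> (snd \<kappa> a) = a"
    and chart_inv_right: "z \<in> snd \<kappa> ` fst \<kappa> \<Longrightarrow> snd \<kappa> (chart_inv \<kappa> z) = z"
    and continuous_on_chart: "continuous_on (fst \<kappa>) (snd \<kappa>)"
    and continuous_on_chart_inv: "continuous_on (snd \<kappa> ` fst \<kappa>) (chart_inv \<kappa>)"
  using assms unfolding is_chart_def homeomorphism_def by auto

lemma analytic_map_in_charts:
  fixes A :: "('m::{t2_space, second_countable_topology}, 'e::real_normed_vector) chart set"
  assumes A: "analytic_atlas A" and f: "analytic_map (product_atlas A A) A (\<lambda>(a, b). f a b)"
    and k: "\<kappa>\<^sub>1 \<in> A" "\<kappa>\<^sub>2 \<in> A" "\<kappa>\<^sub>3 \<in> A" and ab: "a \<in> fst \<kappa>\<^sub>1" "b \<in> fst \<kappa>\<^sub>2" "f a b \<in> fst \<kappa>\<^sub>3"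
  shows "twice_differentiable_at (\<lambda>(z, y). snd \<kappa>\<^sub>3 (f (chart_inv \<kappa>\<^sub>1 z) (chart_inv \<kappa>\<^sub>2 y))) (snd \<kappa>\<^sub>1 a, snd \<kappa>\<^sub>2 b)"
proof -
  let ?k = "(fst \<kappa>\<^sub>1 \<times> fst \<kappa>\<^sub>2, map_prod (snd \<kappa>\<^sub>1) (snd \<kappa>\<^sub>2))"
  let ?T = "(snd \<kappa>\<^sub>1 ` fst \<kappa>\<^sub>1) \<times> (snd \<kappa>\<^sub>2 ` fst \<kappa>\<^sub>2)"
  have ch: "is_chart \<kappa>\<^sub>1" "is_chart \<kappa>\<^sub>2" and fin: "finite_dim TYPE('e)"
    using A k by (auto simp: analytic_atlas_def)
  have "?k \<in> product_atlas A A" using k unfolding product_atlas_def by blast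
  with f k(3) ab
  have "real_analytic_at (\<lambda>z. snd \<kappa>\<^sub>3 ((\<lambda>(a, b). f a b) (chart_inv ?k z))) (snd ?k (a, b))"
    unfolding analytic_map_def by fastforce
  then have "twice_differentiable_at (\<lambda>z. snd \<kappa>\<^sub>3 ((\<lambda>(a, b). f a b) (chart_inv ?k z))) (snd \<kappa>\<^sub>1 a, snd \<kappa>\<^sub>2 b)"
    using fin by (intro real_analytic_twice_differentiable) simp_all
  moreover have "open ?T" using ch by (intro open_Times open_chart_image)
  moreover have "(snd \<kappa>\<^sub>1 a, snd \<kappa>\<^sub>2 b) \<in> ?T" using ab by auto
  moreover have "snd \<kappa>\<^sub>3 ((\<lambda>(a, b). f a b) (chart_inv ?k q))
      = (\<lambda>(z, y). snd \<kappa>\<^sub>3 (f (chart_inv \<kappa>\<^sub>1 z) (chart_inv \<kappa>\<^sub>2 y))) q" if "q \<in> ?T" for q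
  proof -
    obtain c d where q: "q = (snd \<kappa>\<^sub>1 c, snd \<kappa>\<^sub>2 d)" "c \<in> fst \<kappa>\<^sub>1" "d \<in> fst \<kappa>\<^sub>2" using \<open>q \<in> ?T\<close> by auto
    have "inj_on (snd \<kappa>\<^sub>1) (fst \<kappa>\<^sub>1)" "inj_on (snd \<kappa>\<^sub>2) (fst \<kappa>\<^sub>2)"
      using chart_inv_left[OF ch(1)] chart_inv_left[OF ch(2)] by (metis inj_on_inverseI)+
    then have "inj_on (map_prod (snd \<kappa>\<^sub>1) (snd \<kappa>\<^sub>2)) (fst \<kappa>\<^sub>1 \<times> fst \<kappa>\<^sub>2)" by (rule map_prod_inj_on)
    from inv_into_f_f[OF this, of "(c, d)"] have "chart_inv ?k q = (c, d)" using q by simp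
    then show ?thesis using q chart_inv_left[OF ch(1)] chart_inv_left[OF ch(2)] by simp
  qed
  ultimately show ?thesis by (rule twice_differentiable_at_cong)
qed

locale moufang_chart =
  fixes A :: "('m::{t2_space, second_countable_topology}, 'e::real_normed_vector) chart set"
    and m :: "'m \<Rightarrow> 'm \<Rightarrow> 'm" and e :: 'm and \<kappa> :: "('m, 'e) chart"
  assumes loop: "analytic_moufang_loop A m e" and chart: "\<kappa> \<in> A" and e_in: "e \<in> fst \<kappa>"
begin

abbreviation "\<phi> \<equiv> snd \<kappa>"
abbreviation "\<psi> \<equiv> chart_inv \<kappa>"
abbreviation "p \<equiv> snd \<kappa> e"

lemma moufang: "moufang_loop m e" and is_loop: "is_loop m e" and atlas: "analytic_atlas A"
  using loop by (auto simp: analytic_moufang_loop_def moufang_loop_def)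

lemma charts: "\<mu> \<in> A \<Longrightarrow> is_chart \<mu>"
  using atlas by (auto simp: analytic_atlas_def)

lemma chart_around:
  obtains \<mu> where "\<mu> \<in> A" "a \<in> fst \<mu>"
proof -
  have "a \<in> (\<Union>\<mu>\<in>A. fst \<mu>)" using atlas by (simp add: analytic_atlas_def)
  then show thesis using that by blast
qed

lemma mult_e: "m e a = a" "m a e = a"
  using is_loop by (auto simp: is_loop_def)

lemma right_div_self: "right_div m a a = e"
  by (rule right_div_unique[OF is_loop]) (rule mult_e)

lemma analytic_mult: "analytic_map (product_atlas A A) A (\<lambda>(a, b). m a b)"
  and analytic_right_div: "analytic_map (product_atlas A A) A (\<lambda>(b, a). right_div m b a)"
  using loop by (auto simp: analytic_moufang_loop_def)

lemma continuous_mult: "continuous_on UNIV (\<lambda>b. m a b)"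
proof -
  have "continuous_on UNIV (\<lambda>(a, b). m a b)" using analytic_mult by (simp add: analytic_map_def)
  from continuous_on_compose2[OF this, of UNIV "\<lambda>b. (a, b)"] show ?thesis
    by (simp add: continuous_on_Pair)
qed

lemma continuous_inner_map: "continuous_on UNIV (inner_map m a)"
proof -
  have "continuous_on UNIV (\<lambda>(b, a). right_div m b a)" using analytic_right_div by (simp add: analytic_map_def)
  from continuous_on_compose2[OF this, of UNIV "\<lambda>b. (m a b, a)"] show ?thesis
    by (simp add: continuous_on_Pair continuous_mult inner_map_def[abs_def])
qed

lemma open_preimage:
  assumes "continuous_on UNIV f" "open V"
  shows "open {y \<in> \<phi> ` fst \<kappa>. f (\<psi> y) \<in> V}"
proof -
  have "continuous_on (\<phi> ` fst \<kappa>) (\<lambda>y. f (\<psi> y))"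
    by (rule continuous_on_compose2[OF assms(1) continuous_on_chart_inv[OF charts[OF chart]]]) simp
  from continuous_open_preimage[OF this open_chart_image[OF charts[OF chart]] assms(2)]
  show ?thesis by (simp add: vimage_def Int_def)
qed

definition conj_coord :: "'m \<Rightarrow> 'e \<Rightarrow> 'e" where
  "conj_coord a y = \<phi> (inner_map m a (\<psi> y))"

text \<open>For a Lie group, this is the adjoint representation in the coordinates of \<open>\<kappa>\<close>.\<close>

definition Ad :: "'m \<Rightarrow> 'e \<Rightarrow> 'e" where
  "Ad a = frechet_derivative (conj_coord a) (at p)"

lemma p_in: "p \<in> \<phi> ` fst \<kappa>" and \<psi>_p: "\<psi> p = e"
  using e_in chart_inv_left[OF charts[OF chart]] by auto

lemma conj_coord_p: "conj_coord a p = p"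
  by (simp add: conj_coord_def \<psi>_p inner_map_e[OF is_loop])

text \<open>In charts, \<open>inner_map m a\<close> is right division by \<open>a\<close> after left multiplication by \<open>a\<close>, so its
  derivative at \<open>e\<close> is a product of two partial derivatives, each depending differentiably on \<open>a\<close>.\<close>

lemma conj_coord_derivative:
  assumes \<mu>: "\<mu> \<in> A" and a: "a \<in> fst \<mu>"
  obtains S D where "open S" "snd \<mu> a \<in> S" "S \<subseteq> snd \<mu> ` fst \<mu>"
    "\<And>z. z \<in> S \<Longrightarrow> (conj_coord (chart_inv \<mu> z) has_derivative D z) (at p)"
    "\<And>v. (\<lambda>z. D z v) differentiable (at (snd \<mu> a))"
proof -
  let ?z = "snd \<mu> a"
  note ch = charts[OF \<mu>]
  have "m a e \<in> fst \<mu>" using a by (simp add: mult_e)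
  from analytic_map_in_charts[OF atlas analytic_mult \<mu> chart \<mu> a e_in this]
  have "twice_differentiable_at (\<lambda>(z, y). snd \<mu> (m (chart_inv \<mu> z) (\<psi> y))) (?z, p)" .
  then obtain S1 L1 L H1 H2 where S1: "open S1" "(?z, p) \<in> S1"
    and L: "\<And>z y. (z, y) \<in> S1 \<Longrightarrow> ((\<lambda>y. snd \<mu> (m (chart_inv \<mu> z) (\<psi> y))) has_derivative L z y) (at y)"
    and L': "\<And>v. ((\<lambda>(z, y). L z y v) has_derivative H2 v) (at (?z, p))"
    by (rule partial_derivatives) (rule that)
  have "right_div m a a \<in> fst \<kappa>" using e_in by (simp add: right_div_self)
  from analytic_map_in_charts[OF atlas analytic_right_div \<mu> \<mu> chart a a this]
  have "twice_differentiable_at (\<lambda>(w, z). \<phi> (right_div m (chart_inv \<mu> w) (chart_inv \<mu> z))) (?z, ?z)" .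
  then obtain S2 N N2 K1 K2 where S2: "open S2" "(?z, ?z) \<in> S2"
    and N: "\<And>w z. (w, z) \<in> S2 \<Longrightarrow>
        ((\<lambda>w. \<phi> (right_div m (chart_inv \<mu> w) (chart_inv \<mu> z))) has_derivative N w z) (at w)"
    and N': "\<And>v. ((\<lambda>(w, z). N w z v) has_derivative K1 v) (at (?z, ?z))"
    by (rule partial_derivatives) (rule that)
  define S where "S = (\<lambda>z. (z, p)) -` S1 \<inter> (\<lambda>z. (z, z)) -` S2 \<inter> snd \<mu> ` fst \<mu>"
  have S: "open S" "?z \<in> S" "S \<subseteq> snd \<mu> ` fst \<mu>"
    unfolding S_def using S1 S2 a open_chart_image[OF ch]
    by (auto intro!: open_Int open_vimage continuous_intros)
  show thesis
  proof (rule that[OF S, of "\<lambda>z v. N z z (L z p v)"])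
    fix z assume z: "z \<in> S"
    let ?b = "chart_inv \<mu> z"
    have b: "?b \<in> fst \<mu>" "snd \<mu> ?b = z" using z S(3) chart_inv_in[OF ch] chart_inv_right[OF ch] by auto
    have "snd \<mu> (m ?b (\<psi> p)) = z" using b by (simp add: \<psi>_p mult_e)
    then have "((\<lambda>w. \<phi> (right_div m (chart_inv \<mu> w) ?b)) has_derivative N z z) (at (snd \<mu> (m ?b (\<psi> p))))"
      using N[of z z] z by (simp add: S_def)
    moreover have "((\<lambda>y. snd \<mu> (m ?b (\<psi> y))) has_derivative L z p) (at p)"
      using L[of z p] z by (simp add: S_def)
    ultimately have "((\<lambda>y. \<phi> (right_div m (chart_inv \<mu> (snd \<mu> (m ?b (\<psi> y)))) ?b)) has_derivative
        (\<lambda>v. N z z (L z p v))) (at p)"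
      by (rule has_derivative_compose[rotated])
    then show "(conj_coord ?b has_derivative (\<lambda>v. N z z (L z p v))) (at p)"
    proof (rule has_derivative_transform_within_open)
      show "open {y \<in> \<phi> ` fst \<kappa>. m ?b (\<psi> y) \<in> fst \<mu>}"
        by (rule open_preimage[OF continuous_mult open_chart_domain[OF ch]])
      show "p \<in> {y \<in> \<phi> ` fst \<kappa>. m ?b (\<psi> y) \<in> fst \<mu>}" using b e_in by (auto simp: \<psi>_p mult_e)
    qed (auto simp: conj_coord_def inner_map_def chart_inv_left[OF ch])
  next
    fix v
    obtain B :: "'e set" where "finite_basis B" 
      using finite_dim_imp_basis atlas unfolding analytic_atlas_def by blast
    then interpret finite_basis B .
    have "((\<lambda>z. (z, p)) has_derivative (\<lambda>h. (h, 0))) (at ?z)"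
      by (intro has_derivative_Pair has_derivative_const has_derivative_ident)
    from has_derivative_compose[OF this L'[of v]]
    have Lv: "((\<lambda>z. L z p v) has_derivative (\<lambda>h. H2 v (h, 0))) (at ?z)" by simp
    have "((\<lambda>z. (z, z)) has_derivative (\<lambda>h. (h, h))) (at ?z)"
      by (intro has_derivative_Pair has_derivative_ident)
    from has_derivative_compose[OF this N']
    have Nu: "((\<lambda>z. N z z u) has_derivative (\<lambda>h. K1 u (h, h))) (at ?z)" for u by simp
    have lin: "linear (N z z)" if "z \<in> S" for z
      using N[of z z] that by (auto simp: S_def intro: has_derivative_linear)
    from has_derivative_apply[OF Nu S(1,2) lin Lv]
    show "(\<lambda>z. N z z (L z p v)) differentiable (at ?z)" unfolding differentiable_def by blast
  qed
qed

lemma has_derivative_Ad: "(conj_coord a has_derivative Ad a) (at p)"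
proof -
  obtain \<mu> where \<mu>: "\<mu> \<in> A" "a \<in> fst \<mu>" by (rule chart_around)
  obtain S D where "snd \<mu> a \<in> S"
    and D: "\<And>z. z \<in> S \<Longrightarrow> (conj_coord (chart_inv \<mu> z) has_derivative D z) (at p)"
    by (rule conj_coord_derivative[OF \<mu>]) (rule that)
  from D[OF this(1)] have "(conj_coord a has_derivative D (snd \<mu> a)) (at p)"
    by (simp add: chart_inv_left[OF charts[OF \<mu>(1)] \<mu>(2)])
  then show ?thesis unfolding Ad_def by (metis frechet_derivative_at)
qed

lemma Ad_unique: "(conj_coord a has_derivative D) (at p) \<Longrightarrow> Ad a = D"
  by (rule has_derivative_unique[OF has_derivative_Ad])

lemma linear_Ad: "linear (Ad a)"
  by (rule has_derivative_linear[OF has_derivative_Ad])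

lemma Ad_differentiable:
  assumes \<mu>: "\<mu> \<in> A" and a: "a \<in> fst \<mu>"
  shows "(\<lambda>z. Ad (chart_inv \<mu> z) v) differentiable (at (snd \<mu> a))"
proof -
  obtain S D where S: "open S" "snd \<mu> a \<in> S"
    and D: "\<And>z. z \<in> S \<Longrightarrow> (conj_coord (chart_inv \<mu> z) has_derivative D z) (at p)"
      "\<And>v. (\<lambda>z. D z v) differentiable (at (snd \<mu> a))"
    by (rule conj_coord_derivative[OF \<mu> a]) (rule that)
  obtain D' where "((\<lambda>z. D z v) has_derivative D') (at (snd \<mu> a))"
    using D(2) unfolding differentiable_def by blast
  then have "((\<lambda>z. Ad (chart_inv \<mu> z) v) has_derivative D') (at (snd \<mu> a))"
    by (rule has_derivative_transform_within_open[OF _ S]) (simp add: Ad_unique[OF D(1)])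
  then show ?thesis unfolding differentiable_def by blast
qed

lemma continuous_Ad: "continuous_on UNIV (\<lambda>a. Ad a v)"
proof (rule continuous_at_imp_continuous_on, rule ballI)
  fix a
  obtain \<mu> where \<mu>: "\<mu> \<in> A" "a \<in> fst \<mu>" by (rule chart_around)
  note ch = charts[OF \<mu>(1)]
  have "isCont (snd \<mu>) a"
    using continuous_on_chart[OF ch] open_chart_domain[OF ch] \<mu>(2) by (simp add: continuous_on_eq_continuous_at)
  moreover have "isCont (\<lambda>z. Ad (chart_inv \<mu> z) v) (snd \<mu> a)"
    using Ad_differentiable[OF \<mu>] by (rule differentiable_imp_continuous_within)
  ultimately have "isCont (\<lambda>b. Ad (chart_inv \<mu> (snd \<mu> b)) v) a"
    by (rule isCont_o2)
  moreover have "\<forall>\<^sub>F b in nhds a. Ad (chart_inv \<mu> (snd \<mu> b)) v = Ad b v"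
    using open_chart_domain[OF ch] \<mu>(2) unfolding eventually_nhds
    by (intro exI[of _ "fst \<mu>"]) (auto simp: chart_inv_left[OF ch])
  ultimately show "isCont (\<lambda>a. Ad a v) a" using isCont_cong by fast
qed

lemma compact_Ad_orbit:
  assumes "compact (UNIV :: 'm set)"
  shows "compact (range (\<lambda>a. Ad a v))"
  by (rule compact_continuous_image[OF continuous_Ad assms])

text \<open>Powers of an inner map are the inner maps of the powers, so the chain rule carries powers to
  the derivatives.\<close>

lemma Ad_loop_power: "Ad (loop_power m e a n) = Ad a ^^ n"
proof (rule Ad_unique)
  have cont: "continuous_on UNIV (inner_map m a ^^ n)" for n
    by (induction n) (auto intro: continuous_on_compose2[OF continuous_inner_map])
  have fix_e: "(inner_map m a ^^ n) e = e" for n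
    by (induction n) (auto simp: inner_map_e[OF is_loop])
  have "((\<lambda>y. \<phi> ((inner_map m a ^^ n) (\<psi> y))) has_derivative Ad a ^^ n) (at p)"
  proof (induction n)
    case 0
    have "((\<lambda>y. y) has_derivative (\<lambda>v. v)) (at p)" by simp
    then have "((\<lambda>y. \<phi> (\<psi> y)) has_derivative (\<lambda>v. v)) (at p)"
      by (rule has_derivative_transform_within_open[OF _ open_chart_image[OF charts[OF chart]] p_in])
        (simp add: chart_inv_right[OF charts[OF chart]])
    then show ?case by (simp add: id_def)
  next
    case (Suc n)
    have "\<phi> ((inner_map m a ^^ n) (\<psi> p)) = p" by (simp add: \<psi>_p fix_e)
    then have "(conj_coord a has_derivative Ad a) (at (\<phi> ((inner_map m a ^^ n) (\<psi> p))))"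
      using has_derivative_Ad by simp
    from has_derivative_compose[OF Suc this]
    have "((\<lambda>y. conj_coord a (\<phi> ((inner_map m a ^^ n) (\<psi> y)))) has_derivative (Ad a ^^ Suc n)) (at p)"
      by (simp add: o_def)
    then show ?case
    proof (rule has_derivative_transform_within_open)
      show "open {y \<in> \<phi> ` fst \<kappa>. (inner_map m a ^^ n) (\<psi> y) \<in> fst \<kappa>}"
        by (rule open_preimage[OF cont open_chart_domain[OF charts[OF chart]]])
      show "p \<in> {y \<in> \<phi> ` fst \<kappa>. (inner_map m a ^^ n) (\<psi> y) \<in> fst \<kappa>}"
        using p_in e_in by (simp add: \<psi>_p fix_e)
    qed (auto simp: conj_coord_def chart_inv_left[OF charts[OF chart]])
  qed
  then show "(conj_coord (loop_power m e a n) has_derivative Ad a ^^ n) (at p)"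
    by (simp add: conj_coord_def[abs_def] inner_map_loop_power[OF moufang])
qed

lemma Ad_e: "Ad e = (\<lambda>v. v)"
proof (rule Ad_unique)
  show "(conj_coord e has_derivative (\<lambda>v. v)) (at p)"
    by (rule has_derivative_transform_within_open[OF has_derivative_ident open_chart_image[OF charts[OF chart]] p_in])
      (auto simp: conj_coord_def inner_map_e[OF is_loop] chart_inv_left[OF charts[OF chart]])
qed

text \<open>In the coordinates \<open>\<mu>(z, y)\<close> of the multiplication, the inner map satisfies
  \<open>\<mu>(conj_coord (\<psi> z) y, z) = \<mu>(z, y)\<close>. Differentiating at \<open>y = p\<close> and then at \<open>z = p\<close> shows that the derivative
  of \<open>Ad\<close> at \<open>e\<close> is the difference of the mixed second derivatives of \<open>\<mu>\<close> with the two arguments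
  exchanged, by symmetry of second derivatives; the tangent bracket is the same difference.\<close>

lemma Ad_has_derivative_bracket:
    "((\<lambda>z. Ad (\<psi> z) w) has_derivative (\<lambda>v. tangent_bracket m e \<kappa> v w)) (at p)"
  and linear_tangent_bracket: "linear (tangent_bracket m e \<kappa> v)"
proof -
  note ch = charts[OF chart]
  define \<mu> where "\<mu> z y = \<phi> (m (\<psi> z) (\<psi> y))" for z y
  have "m e e \<in> fst \<kappa>" using e_in by (simp add: mult_e)
  from analytic_map_in_charts[OF atlas analytic_mult chart chart chart e_in e_in this]
  have "twice_differentiable_at (\<lambda>(z, y). \<mu> z y) (p, p)" unfolding \<mu>_def .
  then obtain S F1 F2 G1 G2 where S: "open S" "(p, p) \<in> S"
    and F1: "\<And>z y. (z, y) \<in> S \<Longrightarrow> ((\<lambda>z. \<mu> z y) has_derivative F1 z y) (at z)"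
    and F2: "\<And>z y. (z, y) \<in> S \<Longrightarrow> ((\<lambda>y. \<mu> z y) has_derivative F2 z y) (at y)"
    and G1: "\<And>u. ((\<lambda>(z, y). F1 z y u) has_derivative G1 u) (at (p, p))"
    and G2: "\<And>v. ((\<lambda>(z, y). F2 z y v) has_derivative G2 v) (at (p, p))"
    and sym: "\<And>u v. G1 u (0, v) = G2 v (u, 0)"
    by (rule partial_derivatives) (rule that)
  define S' where "S' = (\<lambda>z. (z, p)) -` S \<inter> (\<lambda>z. (p, z)) -` S \<inter> \<phi> ` fst \<kappa>"
  have S': "open S'" "p \<in> S'"
    unfolding S'_def using S e_in open_chart_image[OF ch]
    by (auto intro!: open_Int open_vimage continuous_intros)
  have id: "(f has_derivative (\<lambda>v. v)) (at p)" if "\<And>y. y \<in> \<phi> ` fst \<kappa> \<Longrightarrow> y = f y" for f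
    by (rule has_derivative_transform_within_open[OF has_derivative_ident open_chart_image[OF ch] p_in that])
  have F2_id: "F2 p p = (\<lambda>v. v)" 
    by (rule has_derivative_unique[OF F2[OF S(2)] id]) (auto simp: \<mu>_def \<psi>_p mult_e chart_inv_left[OF ch])
  have F1_id: "F1 p p = (\<lambda>v. v)" 
    by (rule has_derivative_unique[OF F1[OF S(2)] id]) (auto simp: \<mu>_def \<psi>_p mult_e chart_inv_left[OF ch])
  have slice: "((\<lambda>z. F2 z p v) has_derivative (\<lambda>h. G2 v (h, 0))) (at p)" for v
  proof -
    have "((\<lambda>z. (z, p)) has_derivative (\<lambda>h. (h, 0))) (at p)"
      by (intro has_derivative_Pair has_derivative_const has_derivative_ident)
    from has_derivative_compose[OF this G2[of v]] show ?thesis by simp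
  qed
  have slice1: "((\<lambda>z. F1 p z u) has_derivative (\<lambda>h. G1 u (0, h))) (at p)" for u
  proof -
    have "((\<lambda>z. (p, z)) has_derivative (\<lambda>h. (0, h))) (at p)"
      by (intro has_derivative_Pair has_derivative_const has_derivative_ident)
    from has_derivative_compose[OF this G1[of u]] show ?thesis by simp
  qed
  have field: "left_inv_field m e \<kappa> v z = F2 z p v" if "z \<in> S'" for v z
  proof -
    have "(\<mu> z has_derivative F2 z p) (at p)" using F2[of z p] that by (simp add: S'_def)
    from frechet_derivative_at[OF this] show ?thesis
      unfolding left_inv_field_def \<mu>_def by (simp add: fun_eq_iff)
  qed
  have field': "frechet_derivative (left_inv_field m e \<kappa> v) (at p) = (\<lambda>h. G2 v (h, 0))" for v
  proof (rule frechet_derivative_at[symmetric])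
    show "(left_inv_field m e \<kappa> v has_derivative (\<lambda>h. G2 v (h, 0))) (at p)"
      by (rule has_derivative_transform_within_open[OF slice S']) (simp add: field)
  qed
  have bracket: "tangent_bracket m e \<kappa> v w = G2 w (v, 0) - G2 v (w, 0)" for v w
    unfolding tangent_bracket_def lie_bracket_def field' field[OF S'(2)] F2_id ..
  show "linear (tangent_bracket m e \<kappa> v)"
  proof -
    have "linear (G1 v)" "linear (G2 v)" using G1 G2 by (auto intro: has_derivative_linear)
    moreover have "tangent_bracket m e \<kappa> v = (\<lambda>w. G1 v (0, w) - G2 v (w, 0))"
      by (simp add: fun_eq_iff bracket sym)
    moreover have "linear (\<lambda>w. (0::'e, w))" "linear (\<lambda>w. (w, 0::'e))"
      by (auto intro: linearI)
    ultimately show ?thesis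
      using linear_compose[of _ "G1 v"] linear_compose[of _ "G2 v"] 
      by (auto simp: o_def intro!: linear_compose_sub)
  qed
  obtain D where D: "((\<lambda>z. Ad (\<psi> z) w) has_derivative D) (at p)"
    using Ad_differentiable[OF chart e_in, of w] unfolding differentiable_def by blast
  have eq: "F1 p z (Ad (\<psi> z) w) = F2 z p w" if z: "z \<in> S'" for z
  proof -
    have "\<psi> z \<in> fst \<kappa>" and \<phi>\<psi>: "\<phi> (\<psi> z) = z" 
      using z chart_inv_in[OF ch] chart_inv_right[OF ch] by (auto simp: S'_def)
    have "((\<lambda>w. \<mu> w z) has_derivative F1 p z) (at (conj_coord (\<psi> z) p))"
      using F1[of p z] z by (simp add: S'_def conj_coord_p)
    from has_derivative_compose[OF has_derivative_Ad this]
    have "((\<lambda>y. \<mu> (conj_coord (\<psi> z) y) z) has_derivative (\<lambda>v. F1 p z (Ad (\<psi> z) v))) (at p)" .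
    then have "((\<lambda>y. \<mu> z y) has_derivative (\<lambda>v. F1 p z (Ad (\<psi> z) v))) (at p)"
    proof (rule has_derivative_transform_within_open)
      show "open {y \<in> \<phi> ` fst \<kappa>. inner_map m (\<psi> z) (\<psi> y) \<in> fst \<kappa>}"
        by (rule open_preimage[OF continuous_inner_map open_chart_domain[OF ch]])
      show "p \<in> {y \<in> \<phi> ` fst \<kappa>. inner_map m (\<psi> z) (\<psi> y) \<in> fst \<kappa>}"
        using p_in e_in by (simp add: \<psi>_p inner_map_e[OF is_loop])
    qed (auto simp: \<mu>_def conj_coord_def chart_inv_left[OF ch] inner_map_mult[OF is_loop])
    from has_derivative_unique[OF this F2[of z p]] z show ?thesis
      by (simp add: S'_def fun_eq_iff)
  qed
  obtain B :: "'e set" where "finite_basis B" 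
    using finite_dim_imp_basis atlas unfolding analytic_atlas_def by blast
  then interpret finite_basis B .
  have "linear (F1 p z)" if "z \<in> S'" for z
    using F1[of p z] that by (auto simp: S'_def intro: has_derivative_linear)
  from has_derivative_apply[OF slice1 S' this D]
  have "((\<lambda>z. F1 p z (Ad (\<psi> z) w)) has_derivative (\<lambda>h. D h + G1 w (0, h))) (at p)"
    by (simp add: F1_id \<psi>_p Ad_e)
  then have "((\<lambda>z. F2 z p w) has_derivative (\<lambda>h. D h + G1 w (0, h))) (at p)"
    by (rule has_derivative_transform_within_open[OF _ S']) (rule eq)
  from has_derivative_unique[OF slice this] have "D h = tangent_bracket m e \<kappa> h w" for h
    unfolding bracket sym[symmetric] by (simp add: fun_eq_iff)
  then have "D = (\<lambda>v. tangent_bracket m e \<kappa> v w)" by blast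
  with D show "((\<lambda>z. Ad (\<psi> z) w) has_derivative (\<lambda>v. tangent_bracket m e \<kappa> v w)) (at p)" by simp
qed

end

section \<open>The exponential series as a limit of powers\<close>

lemma funpow_binomial:
  fixes X :: "'a::real_vector \<Rightarrow> 'a"
  assumes X: "linear X"
  shows "((\<lambda>v. v + s *\<^sub>R X v) ^^ n) v = (\<Sum>k\<le>n. (real (n choose k) * s ^ k) *\<^sub>R (X ^^ k) v)"
proof (induction n)
  case (Suc n)
  let ?c = "\<lambda>n k. (real (n choose k) * s ^ k) *\<^sub>R (X ^^ k) v"
  have "((\<lambda>v. v + s *\<^sub>R X v) ^^ Suc n) v = (\<Sum>k\<le>n. ?c n k) + s *\<^sub>R X (\<Sum>k\<le>n. ?c n k)"
    by (simp add: Suc)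
  also have "s *\<^sub>R X (\<Sum>k\<le>n. ?c n k) = (\<Sum>k\<le>n. (real (n choose k) * s ^ Suc k) *\<^sub>R (X ^^ Suc k) v)"
    by (simp add: linear_sum[OF X] linear_cmul[OF X] scaleR_sum_right mult_ac)
  also have "(\<Sum>k\<le>n. ?c n k) = (\<Sum>k\<le>Suc n. ?c n k)" by (simp add: binomial_eq_0)
  also have "(\<Sum>k\<le>Suc n. ?c n k) + (\<Sum>k\<le>n. (real (n choose k) * s ^ Suc k) *\<^sub>R (X ^^ Suc k) v)
      = v + ((\<Sum>k\<le>n. ?c n (Suc k)) + (\<Sum>k\<le>n. (real (n choose k) * s ^ Suc k) *\<^sub>R (X ^^ Suc k) v))"
    unfolding sum.atMost_Suc_shift[of "?c n"] by (simp add: add.assoc)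
  also have "\<dots> = v + (\<Sum>k\<le>n. ?c (Suc n) (Suc k))"
    unfolding sum.distrib[symmetric]
    by (intro arg_cong2[where f="(+)"] refl sum.cong)
      (simp only: scaleR_add_left[symmetric] binomial_Suc_Suc of_nat_add distrib_right add.commute)
  also have "\<dots> = (\<Sum>k\<le>Suc n. ?c (Suc n) k)"
    unfolding sum.atMost_Suc_shift[of "?c (Suc n)"] by simp
  finally show ?case .
qed simp

lemma binomial_over_power_le: "real (n choose k) / real n ^ k \<le> 1 / fact k"
proof (cases "n = 0")
  case False
  have "(n choose k) * fact k \<le> n ^ k" by (rule binomial_fact_pow)
  then have "real (n choose k) * fact k \<le> real n ^ k"
    by (metis of_nat_fact of_nat_le_iff of_nat_mult of_nat_power)
  then show ?thesis using False by (simp add: field_simps)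
qed (cases k; simp)

lemma binomial_over_power_tendsto: "(\<lambda>n. real (n choose k) / real n ^ k) \<longlonglongrightarrow> 1 / fact k"
proof -
  have "(\<lambda>n. (\<Prod>i=0..<k. 1 - real i / real n) / fact k) \<longlonglongrightarrow> (\<Prod>i=0..<k. 1 - 0) / fact k"
    by (intro tendsto_intros lim_const_over_n) simp
  moreover have "\<forall>\<^sub>F n in sequentially. (\<Prod>i=0..<k. 1 - real i / real n) / fact k = real (n choose k) / real n ^ k"
    using eventually_gt_at_top[of 0]
  proof eventually_elim
    case (elim n)
    have "(\<Prod>i=0..<k. 1 - real i / real n) = (\<Prod>i=0..<k. (real n - real i) / real n)"
      using elim by (intro prod.cong) (auto simp: field_simps)
    also have "\<dots> = (\<Prod>i=0..<k. real n - real i) / real n ^ k" by (simp add: prod_dividef)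
    finally show ?case by (simp add: binomial_gbinomial gbinomial_prod_rev)
  qed
  ultimately show ?thesis by (simp add: tendsto_cong)
qed

context finite_basis
begin

text \<open>Tannery's theorem is applied to the coordinates of the binomial expansion; working in coordinates
  also gives the convergence of the series, as finite-dimensional spaces are complete.\<close>

lemma exp_series_limit:
  fixes X :: "'a \<Rightarrow> 'a"
  assumes X: "linear X"
  shows "(\<lambda>n. ((\<lambda>v. v + (1 / real n) *\<^sub>R X v) ^^ n) v) \<longlonglongrightarrow> (\<Sum>k. (1 / fact k) *\<^sub>R (X ^^ k) v)"
proof -
  obtain C where C: "C > 0" "\<And>v. norm (X v) \<le> C * norm v"
    using bounded_linear.pos_bounded[OF linear_imp_bounded_linear[OF X]] by (auto simp: mult.commute)
  have Xk: "norm ((X ^^ k) v) \<le> C ^ k * norm v" for k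
  proof (induction k)
    case (Suc k)
    have "norm ((X ^^ Suc k) v) \<le> C * norm ((X ^^ k) v)" using C(2) by simp
    also have "\<dots> \<le> C * (C ^ k * norm v)" using Suc C(1) by simp
    finally show ?case by (simp add: mult.assoc)
  qed simp
  obtain K where K: "K > 0" "\<And>b v. b \<in> B \<Longrightarrow> \<bar>coord b v\<bar> \<le> K * norm v" using coord_bound by blast
  define a where "a b k n = real (n choose k) / real n ^ k * coord b ((X ^^ k) v)" for b k n
  define l where "l b k = 1 / fact k * coord b ((X ^^ k) v)" for b k
  have tan: "summable (\<lambda>k. norm (l b k)) \<and> (\<lambda>n. \<Sum>k. a b k n) \<longlonglongrightarrow> (\<Sum>k. l b k)" if b: "b \<in> B" for b
  proof -
    have lim: "(\<lambda>n. a b k n) \<longlonglongrightarrow> l b k" for k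
      unfolding a_def l_def by (intro tendsto_mult_right binomial_over_power_tendsto)
    have bound: "norm (a b k n) \<le> K * norm v * (C ^ k /\<^sub>R fact k)" for k n
    proof -
      have "norm (a b k n) = real (n choose k) / real n ^ k * \<bar>coord b ((X ^^ k) v)\<bar>"
        by (simp add: a_def abs_mult)
      also have "\<dots> \<le> 1 / fact k * (K * (C ^ k * norm v))"
        using K(2)[OF b, of "(X ^^ k) v"] Xk[of k] K(1) binomial_over_power_le[of n k]
        by (intro mult_mono) (auto intro: order_trans mult_left_mono)
      finally show ?thesis by (simp add: field_simps)
    qed
    have S: "summable (\<lambda>k. K * norm v * (C ^ k /\<^sub>R fact k))"
      by (intro summable_mult summable_exp_generic)
    have "\<forall>\<^sub>F (k, n) in sequentially \<times>\<^sub>F sequentially. norm (a b k n) \<le> K * norm v * (C ^ k /\<^sub>R fact k)"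
      by (rule always_eventually) (use bound in blast)
    from tannerys_theorem[OF lim this S sequentially_bot] show ?thesis by blast
  qed
  have "(\<lambda>k. \<Sum>b\<in>B. l b k *\<^sub>R b) sums (\<Sum>b\<in>B. (\<Sum>k. l b k) *\<^sub>R b)"
  proof (intro sums_sum sums_scaleR_left)
    show "(\<lambda>k. l b k) sums (\<Sum>k. l b k)" if "b \<in> B" for b
      by (rule summable_sums[OF summable_norm_cancel]) (use tan[OF that] in blast)
  qed
  moreover have "(\<Sum>b\<in>B. l b k *\<^sub>R b) = (1 / fact k) *\<^sub>R (X ^^ k) v" for k
    using arg_cong[OF sum_coord[of "(X ^^ k) v"], of "\<lambda>u. (1 / fact k) *\<^sub>R u"]
    by (simp add: l_def scaleR_sum_right)
  ultimately have S: "(\<Sum>k. (1 / fact k) *\<^sub>R (X ^^ k) v) = (\<Sum>b\<in>B. (\<Sum>k. l b k) *\<^sub>R b)"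
    by (simp add: sums_iff)
  have "(\<Sum>b\<in>B. (\<Sum>k. a b k n) *\<^sub>R b) = ((\<lambda>v. v + (1 / real n) *\<^sub>R X v) ^^ n) v" for n
  proof -
    let ?P = "((\<lambda>v. v + (1 / real n) *\<^sub>R X v) ^^ n) v"
    have "(\<Sum>k. a b k n) = coord b ?P" for b
    proof -
      have "(\<Sum>k. a b k n) = (\<Sum>k\<le>n. a b k n)"
        by (rule suminf_finite) (auto simp: a_def binomial_eq_0)
      also have "\<dots> = coord b ?P"
        unfolding funpow_binomial[OF X] linear_sum[OF linear_coord] linear_cmul[OF linear_coord]
        by (simp add: a_def power_inverse divide_inverse)
      finally show ?thesis .
    qed
    then show ?thesis by (simp only: sum_coord)
  qed
  moreover have "(\<lambda>n. \<Sum>b\<in>B. (\<Sum>k. a b k n) *\<^sub>R b) \<longlonglongrightarrow> (\<Sum>b\<in>B. (\<Sum>k. l b k) *\<^sub>R b)"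
    by (intro tendsto_sum tendsto_scaleR tendsto_const) (use tan in blast)
  ultimately show ?thesis unfolding S by simp
qed

text \<open>The powers are compared one factor at a time.\<close>

lemma funpow_diff_bound:
  fixes P Q :: "'b::real_normed_vector \<Rightarrow> 'b"
  assumes P: "linear P" "\<And>v. norm (P v) \<le> M * norm v" and Q: "\<And>v. norm (Q v) \<le> M * norm v"
    and d: "\<And>v. norm (P v - Q v) \<le> d * norm v" "d \<ge> 0" and M: "M \<ge> 1"
  shows "norm ((P ^^ k) v - (Q ^^ k) v) \<le> real k * d * M ^ k * norm v"
proof (induction k)
  case (Suc k)
  have Qk: "norm ((Q ^^ k) v) \<le> M ^ k * norm v" for k
  proof (induction k)
    case (Suc k)
    have "norm ((Q ^^ Suc k) v) \<le> M * norm ((Q ^^ k) v)" using Q by simp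
    also have "\<dots> \<le> M * (M ^ k * norm v)" using Suc M by (intro mult_left_mono) auto
    finally show ?case by (simp add: mult.assoc)
  qed simp
  have "(P ^^ Suc k) v - (Q ^^ Suc k) v = P ((P ^^ k) v - (Q ^^ k) v) + (P ((Q ^^ k) v) - Q ((Q ^^ k) v))"
    by (simp add: linear_diff[OF P(1)])
  also have "norm \<dots> \<le> M * norm ((P ^^ k) v - (Q ^^ k) v) + d * norm ((Q ^^ k) v)"
    by (intro norm_triangle_le add_mono P d)
  also have "\<dots> \<le> M * (real k * d * M ^ k * norm v) + d * (M ^ Suc k * norm v)"
  proof (intro add_mono mult_left_mono Suc)
    have "M ^ k \<le> M ^ Suc k" using M by (intro power_increasing) auto
    then show "norm ((Q ^^ k) v) \<le> M ^ Suc k * norm v"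
      using Qk[of k] by (meson mult_right_mono norm_ge_zero order_trans)
  qed (use M d in auto)
  also have "\<dots> = real (Suc k) * d * M ^ Suc k * norm v" by (simp add: algebra_simps)
  finally show ?case .
qed simp

text \<open>A sequence that agrees with \<open>id + X/n\<close> up to \<open>o(1/n)\<close> has the same \<open>n\<close>-th powers in the limit,
  since the factors have norm at most \<open>1 + O(1/n)\<close>.\<close>

lemma exp_series_limit_perturbed:
  fixes X :: "'a \<Rightarrow> 'a"
  assumes X: "linear X" and T: "\<And>n. linear (T n)"
    and lim: "\<And>v. (\<lambda>n. real n *\<^sub>R (T n v - v)) \<longlonglongrightarrow> X v"
  shows "(\<lambda>n. (T n ^^ n) v) \<longlonglongrightarrow> (\<Sum>k. (1 / fact k) *\<^sub>R (X ^^ k) v)"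
proof -
  define P where "P n v = v + (1 / real n) *\<^sub>R X v" for n v
  obtain C where C: "C > 0" "\<And>v. norm (X v) \<le> C * norm v"
    using bounded_linear.pos_bounded[OF linear_imp_bounded_linear[OF X]] by (auto simp: mult.commute)
  obtain K where K: "K > 0" "\<And>b v. b \<in> B \<Longrightarrow> \<bar>coord b v\<bar> \<le> K * norm v" using coord_bound by blast
  define d where "d n = K * (\<Sum>b\<in>B. norm (T n b - P n b))" for n
  have d0: "d n \<ge> 0" for n unfolding d_def using K(1) by (simp add: sum_nonneg)
  have linP: "linear (P n)" for n
    by (rule linearI) (simp_all add: P_def linear_add[OF X] linear_cmul[OF X] algebra_simps)
  have TP: "norm (T n v - P n v) \<le> d n * norm v" for n v
  proof -
    have "T n v - P n v = (\<Sum>b\<in>B. coord b v *\<^sub>R (T n b - P n b))"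
      using linear_eq_sum_coord[OF linear_compose_sub[OF T[of n] linP[of n]], of v] .
    also have "norm \<dots> \<le> (\<Sum>b\<in>B. (K * norm v) * norm (T n b - P n b))"
      using K(2) by (intro sum_norm_le) (simp add: mult_right_mono)
    finally show ?thesis by (simp add: d_def sum_distrib_left mult_ac)
  qed
  have nd: "(\<lambda>n. real n * d n) \<longlonglongrightarrow> 0"
  proof -
    have "(\<lambda>n. K * (\<Sum>b\<in>B. norm (real n *\<^sub>R (T n b - b) - X b))) \<longlonglongrightarrow> K * (\<Sum>b\<in>B. norm (X b - X b))"
      by (intro tendsto_intros lim)
    moreover have "\<forall>\<^sub>F n in sequentially. K * (\<Sum>b\<in>B. norm (real n *\<^sub>R (T n b - b) - X b)) = real n * d n"
      using eventually_gt_at_top[of 0]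
    proof eventually_elim
      case (elim n)
      have "real n *\<^sub>R (T n b - b) - X b = real n *\<^sub>R (T n b - P n b)" for b
        using elim by (simp add: P_def algebra_simps)
      then show ?case by (simp add: d_def sum_distrib_left mult_ac)
    qed
    ultimately show ?thesis by (simp add: tendsto_cong)
  qed
  have bound: "norm ((T n ^^ n) v - (P n ^^ n) v) \<le> (real n * d n) * exp (C + real n * d n) * norm v"
    if n: "n > 0" for n
  proof -
    define M where "M = 1 + (C / real n + d n)"
    have M: "M \<ge> 1" using C(1) d0[of n] by (simp add: M_def)
    have P: "norm (P n v) \<le> (1 + C / real n) * norm v" for v
    proof -
      have "norm (P n v) \<le> norm v + norm (X v) / real n"
        using norm_triangle_ineq[of v "(1 / real n) *\<^sub>R X v"] by (simp add: P_def)
      also have "\<dots> \<le> norm v + C * norm v / real n" using C(2) by (intro add_left_mono divide_right_mono) auto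
      finally show ?thesis by (simp add: algebra_simps)
    qed
    have PM: "norm (P n v) \<le> M * norm v" for v
      using P[of v] mult_nonneg_nonneg[OF d0[of n] norm_ge_zero[of v]] by (simp add: M_def algebra_simps)
    have TM: "norm (T n v) \<le> M * norm v" for v
      using P[of v] TP[of n v] norm_triangle_ineq[of "T n v - P n v" "P n v"]
      by (simp add: M_def algebra_simps)
    have "norm ((T n ^^ n) v - (P n ^^ n) v) \<le> real n * d n * M ^ n * norm v"
      by (rule funpow_diff_bound[OF T TM PM TP d0 M])
    also have "M ^ n \<le> exp (C / real n + d n) ^ n"
      using M unfolding M_def by (intro power_mono exp_ge_add_one_self) simp
    also have "exp (C / real n + d n) ^ n = exp (C + real n * d n)"
      using n by (simp add: exp_of_nat_mult[symmetric] algebra_simps)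
    finally show ?thesis using d0[of n] by (simp add: mult_left_mono mult_right_mono)
  qed
  have "(\<lambda>n. (real n * d n) * exp (C + real n * d n) * norm v) \<longlonglongrightarrow> 0 * exp (C + 0) * norm v"
    by (intro tendsto_intros nd)
  then have "(\<lambda>n. (T n ^^ n) v - (P n ^^ n) v) \<longlonglongrightarrow> 0"
    by (intro Lim_null_comparison[OF eventually_mono[OF eventually_gt_at_top[of 0] bound]]) simp_all
  moreover have "(\<lambda>n. (P n ^^ n) v) \<longlonglongrightarrow> (\<Sum>k. (1 / fact k) *\<^sub>R (X ^^ k) v)"
    using exp_series_limit[OF X, of v] unfolding P_def .
  ultimately have "(\<lambda>n. ((T n ^^ n) v - (P n ^^ n) v) + (P n ^^ n) v) \<longlonglongrightarrow> 0 + (\<Sum>k. (1 / fact k) *\<^sub>R (X ^^ k) v)"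
    by (rule tendsto_add)
  then show ?thesis by simp
qed

end

lemma has_derivative_imp_scaled_difference:
  assumes f: "(f has_derivative f') (at p)"
  shows "(\<lambda>n. real n *\<^sub>R (f (p + (1 / real n) *\<^sub>R w) - f p)) \<longlonglongrightarrow> f' w"
proof -
  have "((\<lambda>s. p + s *\<^sub>R w) has_derivative (\<lambda>s. s *\<^sub>R w)) (at 0)"
    by (auto intro!: derivative_eq_intros)
  from has_derivative_compose[OF this, of f f'] f
  have "((\<lambda>s. f (p + s *\<^sub>R w)) has_derivative (\<lambda>s. s *\<^sub>R f' w)) (at 0)"
    by (simp add: linear_cmul[OF has_derivative_linear[OF f]])
  then have "(\<lambda>s. norm (f (p + s *\<^sub>R w) - f p - s *\<^sub>R f' w) / norm s) \<midarrow>0\<rightarrow> 0"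
    by (simp add: has_derivative_at)
  moreover have "filterlim (\<lambda>n. 1 / real n) (at 0) sequentially"
    unfolding filterlim_at using lim_const_over_n[of 1] eventually_gt_at_top[of 0]
    by (auto elim: eventually_mono)
  ultimately have "(\<lambda>n. norm (f (p + (1 / real n) *\<^sub>R w) - f p - (1 / real n) *\<^sub>R f' w) / norm (1 / real n)) \<longlonglongrightarrow> 0"
    by (rule filterlim_compose)
  moreover have "\<forall>\<^sub>F n in sequentially. norm (f (p + (1 / real n) *\<^sub>R w) - f p - (1 / real n) *\<^sub>R f' w) / norm (1 / real n)
      = norm (real n *\<^sub>R (f (p + (1 / real n) *\<^sub>R w) - f p) - f' w)"
    using eventually_gt_at_top[of 0]
  proof eventually_elim
    case (elim n)
    have "real n *\<^sub>R (f (p + (1 / real n) *\<^sub>R w) - f p) - f' w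
        = real n *\<^sub>R (f (p + (1 / real n) *\<^sub>R w) - f p - (1 / real n) *\<^sub>R f' w)"
      using elim by (simp add: scaleR_diff_right)
    then show ?case by (simp add: mult.commute)
  qed
  ultimately have "(\<lambda>n. norm (real n *\<^sub>R (f (p + (1 / real n) *\<^sub>R w) - f p) - f' w)) \<longlonglongrightarrow> 0"
    by (simp add: tendsto_cong)
  then show ?thesis by (simp add: tendsto_norm_zero_iff Lim_null[symmetric])
qed

section \<open>Almost periodicity\<close>

text \<open>Here \<open>T n\<close> is \<open>Ad\<close> of the point with coordinates \<open>p + (t/n) x\<close>, whose \<open>n\<close>-th power is again a value of
  \<open>Ad\<close>. For small \<open>n\<close> these coordinates may lie outside the chart; the limit ignores those terms, and
  they are values of \<open>Ad\<close> as well.\<close>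

lemma (in moufang_chart) exp_ad_in_closure:
  "exp_ad (tangent_bracket m e \<kappa>) t x y \<in> closure (range (\<lambda>a. Ad a y))"
proof -
  let ?ad = "tangent_bracket m e \<kappa> x"
  obtain B :: "'e set" where "finite_basis B" 
    using finite_dim_imp_basis atlas unfolding analytic_atlas_def by blast
  then interpret finite_basis B .
  define T where "T n = Ad (\<psi> (p + (1 / real n) *\<^sub>R t *\<^sub>R x))" for n
  define X where "X v = t *\<^sub>R ?ad v" for v
  have X: "linear X"
    unfolding X_def[abs_def] by (rule linear_compose_scale_right[OF linear_tangent_bracket])
  have "(X ^^ k) v = t ^ k *\<^sub>R (?ad ^^ k) v" for k v
    by (induction k) (simp_all add: X_def linear_cmul[OF linear_tangent_bracket])
  then have exp: "exp_ad (tangent_bracket m e \<kappa>) t x y = (\<Sum>k. (1 / fact k) *\<^sub>R (X ^^ k) y)"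
    unfolding exp_ad_def by simp
  have "(\<lambda>n. real n *\<^sub>R (T n v - v)) \<longlonglongrightarrow> X v" for v
  proof -
    have "tangent_bracket m e \<kappa> (t *\<^sub>R x) v = X v"
      using linear_cmul[OF has_derivative_linear[OF Ad_has_derivative_bracket[of v]]] by (simp add: X_def)
    with has_derivative_imp_scaled_difference[OF Ad_has_derivative_bracket[of v], of "t *\<^sub>R x"]
    show ?thesis unfolding T_def by (simp only: \<psi>_p Ad_e)
  qed
  then have "(\<lambda>n. (T n ^^ n) y) \<longlonglongrightarrow> exp_ad (tangent_bracket m e \<kappa>) t x y"
    unfolding exp by (intro exp_series_limit_perturbed X) (simp_all add: T_def linear_Ad)
  moreover have "(T n ^^ n) y \<in> range (\<lambda>a. Ad a y)" for n
    unfolding T_def Ad_loop_power[symmetric] by (rule rangeI)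
  ultimately show ?thesis 
    unfolding closure_sequential by (intro exI[of _ "\<lambda>n. (T n ^^ n) y"] conjI allI)
qed

theorem corollary4p4:
  fixes A :: "('m::{t2_space, second_countable_topology}, 'e::real_normed_vector) chart set"
    and m :: "'m \<Rightarrow> 'm \<Rightarrow> 'm" and e :: 'm
  assumes "analytic_moufang_loop A m e"
    and "compact (UNIV :: 'm set)"
    and "connected (UNIV :: 'm set)"
    and "simply_connected (UNIV :: 'm set)"
  shows "\<forall>\<kappa>\<in>A. e \<in> fst \<kappa> \<longrightarrow> almost_periodic (tangent_bracket m e \<kappa>)"
proof (intro ballI impI)
  fix \<kappa> assume "\<kappa> \<in> A" "e \<in> fst \<kappa>"
  with assms(1) interpret moufang_chart A m e \<kappa> by unfold_locales
  show "almost_periodic (tangent_bracket m e \<kappa>)"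
    unfolding almost_periodic_def
  proof (intro allI)
    fix x y
    let ?K = "range (\<lambda>a. Ad a y)"
    have K: "compact ?K" using assms(2) by (rule compact_Ad_orbit)
    then have "closure ?K = ?K" by (intro closure_closed compact_imp_closed)
    then have "range (\<lambda>t. exp_ad (tangent_bracket m e \<kappa>) t x y) \<subseteq> ?K"
      using exp_ad_in_closure by auto
    then have "closure (range (\<lambda>t. exp_ad (tangent_bracket m e \<kappa>) t x y)) \<subseteq> ?K"
      by (rule closure_minimal) (rule compact_imp_closed[OF K])
    with K show "compact (closure (range (\<lambda>t. exp_ad (tangent_bracket m e \<kappa>) t x y)))"
      by (metis closed_closure compact_Int_closed inf.absorb_iff2)
  qed
qed

end
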